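(* Let $\Phi$ be the root system of type $B_n$ and $1\le d\le 2n-1$. Then \[ \operatorname{Var}(\mathcal{X}_{\Phi^+_{=d}})=\begin{cases} \frac1{24}d+\frac1{12}n+\frac1{12} & d\le\frac n2,\ d\text{ even},\\ \frac1{24}d+\frac1{12}n+\frac1{24} & d\le\frac n2,\ d\text{ odd},\\ \frac1{24}d+\frac1{12}n+\frac16 & \frac n2<d\le\frac23 n,\ d\text{ even},\\ \frac1{24}d+\frac1{12}n+\frac18 & \frac n2<d\le\frac23 n,\ d\text{ odd},\\ \frac1{24}d+\frac1{12}n & \frac23 n<d\le n,\ d\text{ even},\\ \frac1{24}d+\frac1{12}n+\frac18 & \frac23 n\le d\le n,\ d\text{ odd},\\ -\frac18 d+\frac14 n & n\le d,\ d\text{ even},\\ -\frac18 d+\frac14 n+\frac18 & n\le d,\ d\text{ odd}, \end{cases} \] \[ \operatorname{Var}(\mathcal{X}_{\Phi^+_{\le d}})=\begin{cases} \frac1{36}d^3+\frac1{48}d^2+(\frac1{12}n+\frac1{72})d & d\le\frac n2,\ d\text{ even},\\ \frac1{36}d^3+\frac1{48}d^2+(\frac1{12}n+\frac1{72})d+\frac1{48} & d\le\frac n2,\ d\text{ odd},\\ \frac1{36}d^3+\frac3{16}d^2+(-\frac1{12}n+\frac7{72})d+(\frac1{24}n^2-\frac1{24}n) & \frac n2\le d\le\frac23 n,\ d\text{ even},\\ \frac1{36}d^3+\frac3{16}d^2+(-\frac1{12}n+\frac7{72})d+(\frac1{24}n^2-\frac1{24}n+\frac1{48}) & \frac n2\le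 d<\frac23 n,\ d\text{ odd},\\ \frac1{36}d^3+(\frac16 n-\frac1{36})d+(-\frac1{24}n^2+\frac1{24}n) & \frac23 n\le d\le n,\ d\text{ even},\\ \frac1{36}d^3+(\frac16 n+\frac7{72})d+(-\frac1{24}n^2-\frac1{24}n+\frac1{24}) & \frac23 n\le d\le n,\ d\text{ odd},\\ -\frac1{12}d^3+(\frac13 n-\frac1{24})d^2+(-\frac13 n^2+\frac16 n-\frac1{24})d+(\frac19 n^3+\frac1{18}n) & n\le d,\ d\text{ even},\\ -\frac1{12}d^3+(\frac13 n-\frac1{24})d^2+(-\frac13 n^2+\frac16 n+\frac1{12})d+(\frac19 n^3-\frac1{36}n+\frac1{24}) & n\le d,\ d\text{ odd}. \end{cases} \]
   Context: Type $B_n$ is realized in $\mathbb{R}^n$ with standard basis $e_1,\dots,e_n$: simple roots $e_1$ and $e_{i+1}-e_i$ ($1\le i<n$); positive roots $e_i$ ($1\le i\le n$) and $e_j\pm e_i$ ($1\le i<j\le n$); all roots are $\pm e_i$ and $\pm e_j\pm e_i$. Heights: $\operatorname{ht}(e_j-e_i)=j-i$, $\operatorname{ht}(e_i)=i$, $\operatorname{ht}(e_j+e_i)=j+i$. The Weyl group $W$ is the group of signed permutations of $\{\pm1,\dots,\pm n\}$. $\Phi^+_{=d}$ (resp. $\Phi^+_{\le d}$) is the set of positive roots of height exactly $d$ (resp. at most $d$). For $\beta\in\Phi^+$, $\mathcal{X}_\beta$ is the Bernoulli random variable on $W$ (uniform) with $\mathcal{X}_\beta(w)=1$ if $w(\beta)$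 is a negative root and $0$ otherwise; $\mathcal{X}_\Psi=\sum_{\beta\in\Psi}\mathcal{X}_\beta$. *)

theory Defs
  imports "HOL-Probability.Probability"
begin

text \<open>Type B_n realised in R^n. A vector of R^n (with integer coordinates, which
suffices for roots) is a function nat => int whose coordinates are indexed by 1..n
(coordinates outside 1..n are 0 for all vectors we use).\<close>

definition unitv :: "nat \<Rightarrow> nat \<Rightarrow> int" where
  "unitv i = (\<lambda>k. if k = i then 1 else 0)"

definition posRootsB :: "nat \<Rightarrow> (nat \<Rightarrow> int) set" where
  "posRootsB n =
     {unitv i | i. 1 \<le> i \<and> i \<le> n}
   \<union> {(\<lambda>k. unitv j k + unitv i k) | i j. 1 \<le> i \<and> i < j \<and> j \<le> n}
   \<union> {(\<lambda>k. unitv j k - unitv i k) | i j. 1 \<le> i \<and> i < j \<and> j \<le> n}"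

definition negRootsB :: "nat \<Rightarrow> (nat \<Rightarrow> int) set" where
  "negRootsB n = (\<lambda>v. (\<lambda>k. - v k)) ` posRootsB n"

text \<open>Height: sum of the coefficients in the simple roots e_1, e_{i+1}-e_i.
  Since e_k = alpha_1 + ... + alpha_k, ht(v) = sum_k k * v_k; this gives
  ht(e_j - e_i) = j - i, ht(e_i) = i, ht(e_j + e_i) = j + i.\<close>
definition htB :: "nat \<Rightarrow> (nat \<Rightarrow> int) \<Rightarrow> int" where
  "htB n v = (\<Sum>k = 1..n. int k * v k)"

text \<open>The Weyl group: signed permutations of {+-1,...,+-n}, as maps on int that are
  bijections of {+-1,...,+-n}, odd (w(-x) = -w(x)), and the identity elsewhere.\<close>
definition signedPerms :: "nat \<Rightarrow> (int \<Rightarrow> int) set" where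
  "signedPerms n = {w. bij_betw w ({- int n .. int n} - {0}) ({- int n .. int n} - {0})
                        \<and> (\<forall>x. w (- x) = - w x)
                        \<and> (\<forall>x. x \<notin> {- int n .. int n} - {0} \<longrightarrow> w x = x)}"

text \<open>Action of a signed permutation on R^n: w(e_i) = sgn(w(i)) e_{|w(i)|}, extended linearly.\<close>
definition actB :: "nat \<Rightarrow> (int \<Rightarrow> int) \<Rightarrow> (nat \<Rightarrow> int) \<Rightarrow> (nat \<Rightarrow> int)" where
  "actB n w v = (\<lambda>k. \<Sum>i = 1..n. v i * sgn (w (int i)) * unitv (nat \<bar>w (int i)\<bar>) k)"

definition Xroot :: "nat \<Rightarrow> (nat \<Rightarrow> int) \<Rightarrow> (int \<Rightarrow> int) \<Rightarrow> real" where
  "Xroot n \<beta> w = (if actB n w \<beta> \<in> negRootsB n then 1 else 0)"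

definition Xset :: "nat \<Rightarrow> (nat \<Rightarrow> int) set \<Rightarrow> (int \<Rightarrow> int) \<Rightarrow> real" where
  "Xset n \<Psi> w = (\<Sum>\<beta>\<in>\<Psi>. Xroot n \<beta> w)"

definition posRootsEq :: "nat \<Rightarrow> nat \<Rightarrow> (nat \<Rightarrow> int) set" where
  "posRootsEq n d = {\<beta> \<in> posRootsB n. htB n \<beta> = int d}"

definition posRootsLe :: "nat \<Rightarrow> nat \<Rightarrow> (nat \<Rightarrow> int) set" where
  "posRootsLe n d = {\<beta> \<in> posRootsB n. htB n \<beta> \<le> int d}"

definition VarB :: "nat \<Rightarrow> (nat \<Rightarrow> int) set \<Rightarrow> real" where
  "VarB n \<Psi> = measure_pmf.variance (pmf_of_set (signedPerms n)) (Xset n \<Psi>)"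

end

theory Submission
  imports Defs
begin

text \<open>Up to centring, \<open>X\<^sub>\<beta>(w)\<close> is half the sign of the linear form \<open>\<beta>\<close> at the point \<open>(w 1, \<dots>, w n)\<close>, so the
  covariance of two such variables depends only on the rank two root system spanned by the two
  roots. Symmetry under reflections gives the mean of a product of two signs: with \<open>\<langle>\<beta>, \<gamma>\<rangle>\<close> the
  standard inner product it is \<open>\<langle>\<beta>, \<gamma>\<rangle>\<close> for two short roots, \<open>\<langle>\<beta>, \<gamma>\<rangle> / 2\<close> for a short and a long one,
  and \<open>\<langle>\<beta>, \<gamma>\<rangle> / 3\<close> for two long ones, plus \<open>1/3\<close> if these coincide. By bilinearity four times the
  variance is therefore \<open>|v|\<^sup>2 / 3 + \<langle>v, u\<rangle> + |u|\<^sup>2\<close> plus a third of the number of long roots, where \<open>v\<close>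
  and \<open>u\<close> are the sums of the long and the short roots. The coordinates of \<open>v\<close> and \<open>u\<close> are
  piecewise linear in the index, with breakpoints near \<open>d/2\<close>, \<open>d\<close> and \<open>\<bar>n - d\<bar>\<close>; the order of these
  is what the case distinction of the theorem records.\<close>

subsection \<open>Signed permutations\<close>

abbreviation sidx :: "nat \<Rightarrow> int set" where
  "sidx n \<equiv> {- int n..int n} - {0}"

text \<open>Brings in the theory of \<open>permutes\<close>, which supplies finiteness, injectivity
  and closure under composition.\<close>

lemma signedPerms_eq: "signedPerms n = {w. w permutes sidx n \<and> (\<forall>x. w (- x) = - w x)}"
proof -
  have "w permutes S \<longleftrightarrow> bij_betw w S S \<and> (\<forall>x. x \<notin> S \<longrightarrow> w x = x)" for w :: "int \<Rightarrow> int" and S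
    by (meson bij_imp_permutes permutes_imp_bij permutes_not_in)
  then show ?thesis by (auto simp only: signedPerms_def)
qed

lemma finite_signedPerms: "finite (signedPerms n)"
  by (rule finite_subset[OF _ finite_permutations[of "sidx n"]]) (auto simp: signedPerms_eq)

lemma id_in_signedPerms: "id \<in> signedPerms n"
  by (simp add: signedPerms_eq)

lemma signedPerms_odd: "w \<in> signedPerms n \<Longrightarrow> w (- x) = - w x"
  by (simp add: signedPerms_eq)

lemma signedPerms_zero: "w \<in> signedPerms n \<Longrightarrow> w 0 = 0"
  using signedPerms_odd[of w n 0] by simp

lemma signedPerms_inj: "w \<in> signedPerms n \<Longrightarrow> w x = w y \<longleftrightarrow> x = y"
  unfolding signedPerms_eq using permutes_inj by (auto dest: injD)

lemma signedPerms_eq_0_iff: "w \<in> signedPerms n \<Longrightarrow> w x = 0 \<longleftrightarrow> x = 0"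
  using signedPerms_inj[of w n x 0] signedPerms_zero[of w n] by simp

lemma signedPerms_abs_eq_iff: "w \<in> signedPerms n \<Longrightarrow> \<bar>w x\<bar> = \<bar>w y\<bar> \<longleftrightarrow> \<bar>x\<bar> = \<bar>y\<bar>"
  using signedPerms_inj[of w n x y] signedPerms_inj[of w n x "- y"] signedPerms_odd[of w n y]
  by (simp add: abs_eq_iff)

lemma signedPerms_abs_le:
  assumes "w \<in> signedPerms n" "\<bar>x\<bar> \<le> int n" shows "\<bar>w x\<bar> \<le> int n"
proof (cases "x = 0")
  case True
  then show ?thesis using signedPerms_zero[OF assms(1)] by simp
next
  case False
  then have "w x \<in> sidx n"
    using assms by (subst permutes_in_image[of w "sidx n" x]) (auto simp: signedPerms_eq)
  then show ?thesis by auto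
qed


subsection \<open>Positive roots as pairs of signed indices\<close>

text \<open>Since \<open>sgn 0 = 0\<close>, the index 0 gives the zero vector; this puts short and
  long roots into one shape.\<close>

definition svec :: "int \<Rightarrow> nat \<Rightarrow> int" where
  "svec x k = sgn x * unitv (nat \<bar>x\<bar>) k"

lemma svec_minus: "svec (- x) k = - svec x k"
  by (simp add: svec_def)

lemma svec_apply: "k \<ge> 1 \<Longrightarrow> svec x k = (if x = int k then 1 else if x = - int k then -1 else 0)"
  by (auto simp: svec_def unitv_def sgn_if)

text \<open>The pair \<open>(a, b)\<close> encodes the root \<open>e\<^sub>a - e\<^sub>b\<close>, where \<open>e\<^sub>-\<^sub>i = - e\<^sub>i\<close> and \<open>e\<^sub>0 = 0\<close>; its height is
  \<open>a - b\<close>, and short roots are the pairs with \<open>b = 0\<close>.\<close>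

definition root_of :: "int \<times> int \<Rightarrow> nat \<Rightarrow> int" where
  "root_of p = (\<lambda>k. svec (fst p) k - svec (snd p) k)"

text \<open>\<open>(a, b)\<close> and \<open>(- b, - a)\<close> encode the same root; the condition
  selects the encoding led by the larger absolute index, whose sign is + exactly for positive
  roots.\<close>

definition rpairs :: "nat \<Rightarrow> (int \<times> int) set" where
  "rpairs n = {(a, b). a \<le> int n \<and> \<bar>b\<bar> < a}"

lemma finite_rpairs: "finite (rpairs n)"
  by (rule finite_subset[of _ "{0..int n} \<times> {- int n..int n}"]) (auto simp: rpairs_def)

lemma posRootsB_eq: "posRootsB n = root_of ` rpairs n"
proof (intro subset_antisym subsetI)
  fix v assume "v \<in> posRootsB n"
  then consider i where "1 \<le> i" "i \<le> n" "v = unitv i"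
    | i j where "1 \<le> i" "i < j" "j \<le> n" "v = (\<lambda>k. unitv j k + unitv i k)"
    | i j where "1 \<le> i" "i < j" "j \<le> n" "v = (\<lambda>k. unitv j k - unitv i k)"
    unfolding posRootsB_def by blast
  then show "v \<in> root_of ` rpairs n"
  proof cases
    case 1
    then have "v = root_of (int i, 0)" "(int i, 0) \<in> rpairs n"
      by (auto simp: root_of_def svec_def rpairs_def fun_eq_iff)
    then show ?thesis by blast
  next
    case 2
    then have "v = root_of (int j, - int i)" "(int j, - int i) \<in> rpairs n"
      by (auto simp: root_of_def svec_def rpairs_def fun_eq_iff)
    then show ?thesis by blast
  next
    case 3
    then have "v = root_of (int j, int i)" "(int j, int i) \<in> rpairs n"
      by (auto simp: root_of_def svec_def rpairs_def fun_eq_iff)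
    then show ?thesis by blast
  qed
next
  fix v assume "v \<in> root_of ` rpairs n"
  then obtain a b where ab: "a \<le> int n" "\<bar>b\<bar> < a" "v = root_of (a, b)"
    by (auto simp: rpairs_def)
  define j where "j = nat a"
  have j: "a = int j" using ab by (simp add: j_def)
  consider "b = 0" | i where "i > 0" "b = int i" | i where "i > 0" "b = - int i"
    by (cases b rule: int_cases3) auto
  then show "v \<in> posRootsB n"
  proof cases
    case 1
    then have "v = unitv j" "1 \<le> j" "j \<le> n"
      using ab j by (auto simp: root_of_def svec_def fun_eq_iff)
    then show ?thesis by (auto simp: posRootsB_def)
  next
    case (2 i)
    then have "v = (\<lambda>k. unitv j k - unitv i k)" "1 \<le> i" "i < j" "j \<le> n"
      using ab j by (auto simp: root_of_def svec_def fun_eq_iff)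
    then show ?thesis unfolding posRootsB_def by blast
  next
    case (3 i)
    then have "v = (\<lambda>k. unitv j k + unitv i k)" "1 \<le> i" "i < j" "j \<le> n"
      using ab j by (auto simp: root_of_def svec_def fun_eq_iff)
    then show ?thesis unfolding posRootsB_def by blast
  qed
qed

lemma htB_svec: 
  assumes "\<bar>x\<bar> \<le> int n"
  shows "htB n (svec x) = x"
proof -
  have "htB n (svec x) = (\<Sum>k = 1..n. if k = nat \<bar>x\<bar> then x else 0)"
    unfolding htB_def by (intro sum.cong) (auto simp: svec_def unitv_def sgn_if)
  also have "\<dots> = x"
    using assms by (cases "x = 0") auto
  finally show ?thesis .
qed

lemma htB_diff: "htB n (\<lambda>k. u k - v k) = htB n u - htB n v"
  by (simp add: htB_def algebra_simps sum_subtractf)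

lemma htB_svec_diff:
  "\<bar>x\<bar> \<le> int n \<Longrightarrow> \<bar>y\<bar> \<le> int n \<Longrightarrow> htB n (\<lambda>k. svec x k - svec y k) = x - y"
  by (simp add: htB_diff htB_svec)

lemma htB_root_of: "p \<in> rpairs n \<Longrightarrow> htB n (root_of p) = fst p - snd p"
  by (auto simp: root_of_def rpairs_def htB_svec_diff)

text \<open>The first component is the largest index with a nonzero coordinate, and the height then
  determines the second.\<close>

lemma inj_on_root_of: "inj_on root_of (rpairs n)"
proof -
  have le: "a' \<le> a" if "(a, b) \<in> rpairs n" "(a', b') \<in> rpairs n" "root_of (a, b) = root_of (a', b')"
    for a b a' b'
  proof (rule ccontr)
    assume "\<not> a' \<le> a"
    \<comment> \<open>At coordinate \<open>a'\<close> the right side is 1, whereas all nonzero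
      coordinates of the left side have smaller index.\<close>
    moreover have "root_of (a, b) (nat a') = root_of (a', b') (nat a')"
      using that by simp
    ultimately show False
      using that by (auto simp: root_of_def svec_def unitv_def rpairs_def split: if_splits)
  qed
  show ?thesis
  proof (rule inj_onI, clarify)
    fix a b a' b'
    assume *: "(a, b) \<in> rpairs n" "(a', b') \<in> rpairs n" "root_of (a, b) = root_of (a', b')"
    have "a - b = a' - b'"
      using * htB_root_of[of "(a, b)" n] htB_root_of[of "(a', b')" n] by simp
    then show "a = a' \<and> b = b'"
      using le[OF *] le[OF *(2,1) *(3)[symmetric]] by auto
  qed
qed

text \<open>Negative roots have negative height, and the vector has height \<open>x - y\<close>;
  conversely, for \<open>x < y\<close> its negative is a positive root.\<close>

lemma svec_diff_negRoot_iff: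
  assumes "\<bar>x\<bar> \<le> int n" "\<bar>y\<bar> \<le> int n" "\<bar>x\<bar> \<noteq> \<bar>y\<bar>"
  shows "(\<lambda>k. svec x k - svec y k) \<in> negRootsB n \<longleftrightarrow> x < y"
proof
  assume "(\<lambda>k. svec x k - svec y k) \<in> negRootsB n"
  then obtain p where p: "p \<in> rpairs n" "(\<lambda>k. svec x k - svec y k) = (\<lambda>k. - root_of p k)"
    by (auto simp: negRootsB_def posRootsB_eq)
  then have "x - y = - (fst p - snd p)"
    using htB_svec_diff[OF assms(1,2)] htB_root_of[OF p(1)] by (simp add: htB_def sum_negf)
  then show "x < y" using p(1) by (auto simp: rpairs_def)
next
  assume "x < y"
  \<comment> \<open>Of the two encodings of e_y - e_x, the one led by the larger absolute
    value.\<close>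
  define p where "p = (if \<bar>x\<bar> < \<bar>y\<bar> then (y, x) else (- x, - y))"
  have "p \<in> rpairs n" using assms \<open>x < y\<close> by (auto simp: p_def rpairs_def)
  moreover have "(\<lambda>k. svec x k - svec y k) = (\<lambda>k. - root_of p k)"
    by (auto simp: p_def root_of_def svec_minus)
  ultimately show "(\<lambda>k. svec x k - svec y k) \<in> negRootsB n"
    by (auto simp: negRootsB_def posRootsB_eq)
qed

text \<open>\<open>actB\<close> refers to positive indices only; oddness of \<open>w\<close> extends
  its effect to negative ones.\<close>

lemma actB_svec:
  assumes "w \<in> signedPerms n" "\<bar>x\<bar> \<le> int n"
  shows "actB n w (svec x) k = svec (w x) k"
proof -
  have "actB n w (svec x) k = (\<Sum>i = 1..n. if i = nat \<bar>x\<bar> then svec (w x) k else 0)"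
    unfolding actB_def
  proof (intro sum.cong refl)
    fix i assume i: "i \<in> {1..n}"
    have "i = nat \<bar>x\<bar> \<longleftrightarrow> x = int i \<or> x = - int i" by linarith
    then consider "x = int i" | "x = - int i" | "i \<noteq> nat \<bar>x\<bar>" "x \<noteq> int i" "x \<noteq> - int i" by blast
    then show "svec x i * sgn (w (int i)) * unitv (nat \<bar>w (int i)\<bar>) k
        = (if i = nat \<bar>x\<bar> then svec (w x) k else 0)"
      by cases (use i in \<open>auto simp: svec_apply signedPerms_odd[OF assms(1)] svec_def unitv_def\<close>)
  qed
  \<comment> \<open>For \<open>x = 0\<close> no summand is selected, and the right side vanishes
    because \<open>w 0 = 0\<close>.\<close>
  also have "\<dots> = svec (w x) k"
    using assms by (cases "x = 0") (auto simp: signedPerms_zero svec_def)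
  finally show ?thesis .
qed

lemma actB_root_of:
  assumes "w \<in> signedPerms n" "p \<in> rpairs n"
  shows "actB n w (root_of p) = (\<lambda>k. svec (w (fst p)) k - svec (w (snd p)) k)"
proof -
  have "actB n w (root_of p) k = actB n w (svec (fst p)) k - actB n w (svec (snd p)) k" for k
    by (simp add: actB_def root_of_def algebra_simps sum_subtractf)
  then show ?thesis using assms by (auto simp: actB_svec rpairs_def)
qed

definition rsgn :: "(int \<Rightarrow> int) \<Rightarrow> int \<times> int \<Rightarrow> real" where
  "rsgn w p = of_int (sgn (w (fst p) - w (snd p)))"

text \<open>The image is the difference of the signed basis vectors at \<open>w (fst p)\<close> and
  \<open>w (snd p)\<close>, negative iff the former number is smaller. Their absolute values differ,
  so the sign is never 0 and the indicator is affine in it.\<close>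

lemma Xroot_root_of:
  assumes "w \<in> signedPerms n" "p \<in> rpairs n"
  shows "Xroot n (root_of p) w = 1/2 - rsgn w p / 2"
proof -
  have p: "\<bar>fst p\<bar> \<le> int n" "\<bar>snd p\<bar> \<le> int n" "\<bar>fst p\<bar> \<noteq> \<bar>snd p\<bar>"
    using assms(2) by (auto simp: rpairs_def)
  then have "\<bar>w (fst p)\<bar> \<noteq> \<bar>w (snd p)\<bar>"
    using signedPerms_abs_eq_iff[OF assms(1)] by simp
  then show ?thesis
    using svec_diff_negRoot_iff[of "w (fst p)" n "w (snd p)"] p signedPerms_abs_le[OF assms(1)]
    by (auto simp: Xroot_def actB_root_of[OF assms] rsgn_def sgn_if)
qed

lemma Xset_root_of:
  assumes "w \<in> signedPerms n" "P \<subseteq> rpairs n"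
  shows "Xset n (root_of ` P) w = real (card P) / 2 - (\<Sum>p\<in>P. rsgn w p) / 2"
proof -
  have "Xset n (root_of ` P) w = (\<Sum>p\<in>P. Xroot n (root_of p) w)"
    unfolding Xset_def using inj_on_subset[OF inj_on_root_of assms(2)] by (simp add: sum.reindex)
  also have "\<dots> = (\<Sum>p\<in>P. 1/2 - rsgn w p / 2)"
    using assms by (intro sum.cong) (auto simp: Xroot_root_of)
  finally show ?thesis by (simp add: sum_subtractf sum_divide_distrib)
qed

subsection \<open>Averages over the Weyl group\<close>

definition avg :: "nat \<Rightarrow> ((int \<Rightarrow> int) \<Rightarrow> real) \<Rightarrow> real" where
  "avg n f = (\<Sum>w\<in>signedPerms n. f w) / real (card (signedPerms n))"

lemma expectation_eq_avg: "measure_pmf.expectation (pmf_of_set (signedPerms n)) f = avg n f"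
  unfolding avg_def using finite_signedPerms id_in_signedPerms
  by (subst integral_pmf_of_set) auto

lemma avg_cong: "(\<And>w. w \<in> signedPerms n \<Longrightarrow> f w = g w) \<Longrightarrow> avg n f = avg n g"
  by (simp add: avg_def)

lemma avg_const: "avg n (\<lambda>w. c) = c"
  using id_in_signedPerms[of n] finite_signedPerms[of n] by (auto simp: avg_def card_eq_0_iff)

lemma avg_add: "avg n (\<lambda>w. f w + g w) = avg n f + avg n g"
  by (simp add: avg_def sum.distrib add_divide_distrib)

lemma avg_minus: "avg n (\<lambda>w. - f w) = - avg n f"
  by (simp add: avg_def sum_negf)

lemma avg_cmult: "avg n (\<lambda>w. c * f w) = c * avg n f"
  by (simp add: avg_def sum_distrib_left)

lemma avg_sum: "avg n (\<lambda>w. \<Sum>i\<in>A. f i w) = (\<Sum>i\<in>A. avg n (f i))"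
  unfolding avg_def by (subst sum.swap) (simp add: sum_divide_distrib)

text \<open>For \<open>q = - p\<close> this is the sign change in coordinate \<open>\<bar>p\<bar>\<close>, so all reflections of
  type B are covered.\<close>

definition refl_swap :: "int \<Rightarrow> int \<Rightarrow> int \<Rightarrow> int" where
  "refl_swap p q x = (if x = p then q else if x = q then p
     else if x = - p then - q else if x = - q then - p else x)"

lemma refl_swap_apply:
  assumes "p \<noteq> 0" "q \<noteq> 0"
  shows "refl_swap p q p = q" "refl_swap p q q = p"
    "refl_swap p q (- p) = - q" "refl_swap p q (- q) = - p"
    "\<bar>x\<bar> \<noteq> \<bar>p\<bar> \<Longrightarrow> \<bar>x\<bar> \<noteq> \<bar>q\<bar> \<Longrightarrow> refl_swap p q x = x"
  using assms by (auto simp: refl_swap_def)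

lemma refl_swap_cases:
  fixes p q x :: int
  obtains "x = p" | "x = q" | "x = - p" | "x = - q" | "\<bar>x\<bar> \<noteq> \<bar>p\<bar>" "\<bar>x\<bar> \<noteq> \<bar>q\<bar>"
  by linarith

lemma refl_swap_involution: "p \<noteq> 0 \<Longrightarrow> q \<noteq> 0 \<Longrightarrow> refl_swap p q (refl_swap p q x) = x"
  by (rule refl_swap_cases[where x = x and p = p and q = q]) (auto simp: refl_swap_apply)

lemma refl_swap_minus: "p \<noteq> 0 \<Longrightarrow> q \<noteq> 0 \<Longrightarrow> refl_swap p q (- x) = - refl_swap p q x"
  by (rule refl_swap_cases[where x = x and p = p and q = q]) (auto simp: refl_swap_apply)

lemma refl_swap_mem: "p \<in> sidx n \<Longrightarrow> q \<in> sidx n \<Longrightarrow> x \<in> sidx n \<Longrightarrow> refl_swap p q x \<in> sidx n"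
  by (rule refl_swap_cases[where x = x and p = p and q = q]) (auto simp: refl_swap_apply)

lemma refl_swap_in:
  assumes "p \<in> sidx n" "q \<in> sidx n" 
  shows "refl_swap p q \<in> signedPerms n"
proof -
  have nz: "p \<noteq> 0" "q \<noteq> 0" using assms by auto
  have "bij_betw (refl_swap p q) (sidx n) (sidx n)"
    by (rule bij_betwI[where g = "refl_swap p q"])
       (use refl_swap_mem[OF assms] refl_swap_involution[OF nz] in blast)+
  moreover have "refl_swap p q x = x" if "x \<notin> sidx n" for x
    using that assms by (intro refl_swap_apply(5)) auto
  ultimately show ?thesis
    using refl_swap_minus[OF nz] by (simp add: signedPerms_def)
qed

text \<open>Right composition with a reflection is an involution of the group, hence only permutes
  the terms of the sum.\<close>

lemma avg_refl_swap:
  assumes "p \<in> sidx n" "q \<in> sidx n"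
  shows "avg n (\<lambda>w. f (w \<circ> refl_swap p q)) = avg n f"
proof -
  let ?t = "refl_swap p q"
  have nz: "p \<noteq> 0" "q \<noteq> 0" using assms by auto
  have comp: "w \<circ> ?t \<in> signedPerms n" if "w \<in> signedPerms n" for w
    using that refl_swap_in[OF assms] by (simp add: signedPerms_eq permutes_compose)
  have inv: "(w \<circ> ?t) \<circ> ?t = w" for w :: "int \<Rightarrow> int"
    by (simp add: fun_eq_iff refl_swap_involution[OF nz])
  have "(\<Sum>w\<in>signedPerms n. f (w \<circ> ?t)) = (\<Sum>w\<in>signedPerms n. f w)"
    by (rule sum.reindex_bij_witness[where i = "\<lambda>w. w \<circ> ?t" and j = "\<lambda>w. w \<circ> ?t"])
       (use comp inv in auto)
  then show ?thesis by (simp add: avg_def)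
qed

lemma avg_eq_0:
  assumes "p \<in> sidx n" "q \<in> sidx n" "\<And>w. w \<in> signedPerms n \<Longrightarrow> f (w \<circ> refl_swap p q) = - f w"
  shows "avg n f = 0"
proof -
  have "avg n f = avg n (\<lambda>w. - f w)"
    using avg_refl_swap[OF assms(1,2), of f] avg_cong[OF assms(3)] by simp
  then show ?thesis by (simp add: avg_minus)
qed

section \<open>Sign correlations and their symmetries\<close>

definition corr :: "nat \<Rightarrow> int \<Rightarrow> int \<Rightarrow> int \<Rightarrow> int \<Rightarrow> real" where
  "corr n p q r s = avg n (\<lambda>w. of_int (sgn (w p - w q) * sgn (w r - w s)))"

lemma avg_rsgn_mult: "avg n (\<lambda>w. rsgn w (a, b) * rsgn w (c, d)) = corr n a b c d"
  by (simp add: corr_def rsgn_def)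

lemma corr_refl_swap:
  assumes "p \<in> sidx n" "q \<in> sidx n"
  shows "corr n (refl_swap p q a) (refl_swap p q b) (refl_swap p q c) (refl_swap p q d) = corr n a b c d"
  using avg_refl_swap[OF assms, of "\<lambda>w. of_int (sgn (w a - w b) * sgn (w c - w d))"]
  by (simp add: corr_def)

lemma corr_commute: "corr n p q r s = corr n r s p q"
  by (simp add: corr_def mult.commute)

lemma corr_neg: "corr n p q s r = - corr n p q r s"
proof -
  have "of_int (sgn (w p - w q) * sgn (w s - w r)) = - (of_int (sgn (w p - w q) * sgn (w r - w s)) :: real)"
    for w :: "int \<Rightarrow> int"
    by (auto simp: sgn_if)
  then show ?thesis by (simp add: corr_def avg_minus)
qed

text \<open>\<open>(- s, - r)\<close> is the other encoding of the root \<open>(r, s)\<close>, and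
  \<open>w\<close> is odd.\<close>

lemma corr_uminus: "corr n p q (- s) (- r) = corr n p q r s"
  unfolding corr_def by (rule avg_cong) (simp add: signedPerms_odd)

lemma corr_self: "p \<noteq> q \<Longrightarrow> corr n p q p q = 1"
proof -
  assume "p \<noteq> q"
  then have "corr n p q p q = avg n (\<lambda>w. 1)"
    unfolding corr_def by (intro avg_cong) (auto simp: sgn_if signedPerms_inj)
  then show ?thesis by (simp add: avg_const)
qed

text \<open>Of three distinct numbers exactly one lies between the other two; it contributes \<open>-1\<close> to
  the sum of the three products of signs, the others \<open>1\<close> each.\<close>

lemma corr_common_index:
  assumes "p \<in> sidx n" "q \<in> sidx n" "r \<in> sidx n" "\<bar>p\<bar> \<noteq> \<bar>q\<bar>" "\<bar>p\<bar> \<noteq> \<bar>r\<bar>" "\<bar>q\<bar> \<noteq> \<bar>r\<bar>"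
  shows "corr n p q p r = 1/3"
proof -
  have nz: "p \<noteq> 0" "q \<noteq> 0" "r \<noteq> 0" using assms by auto
  have ne: "p \<noteq> q" "p \<noteq> r" "q \<noteq> r" using assms by auto
  \<comment> \<open>Exchanging \<open>p\<close> with \<open>q\<close> or with \<open>r\<close>
    changes the common index, so the three averages are equal.\<close>
  have "corr n q p q r = corr n p q p r"
    using corr_refl_swap[OF assms(1,2), of p q p r] nz assms by (simp add: refl_swap_apply)
  moreover have "corr n r q r p = corr n p q p r"
    using corr_refl_swap[OF assms(1,3), of p q p r] nz assms by (simp add: refl_swap_apply)
  moreover have "corr n p q p r + corr n q p q r + corr n r q r p = avg n (\<lambda>w. 1)"
    unfolding corr_def avg_add[symmetric]
  proof (rule avg_cong)
    fix w assume "w \<in> signedPerms n"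
    then have "w p \<noteq> w q" "w p \<noteq> w r" "w q \<noteq> w r"
      using ne by (simp_all add: signedPerms_inj)
    then show "of_int (sgn (w p - w q) * sgn (w p - w r)) + of_int (sgn (w q - w p) * sgn (w q - w r))
        + of_int (sgn (w r - w q) * sgn (w r - w p)) = (1::real)"
      by (auto simp: sgn_if)
  qed
  ultimately show ?thesis by (simp add: avg_const)
qed

text \<open>In the four terms of the sum below the larger of \<open>\<bar>w p\<bar>\<close>, \<open>\<bar>w q\<bar>\<close> decides the signs:
  two of them are \<open>1\<close> and the other two cancel.\<close>

lemma corr_short_long:
  assumes "p \<in> sidx n" "q \<in> sidx n" "\<bar>p\<bar> \<noteq> \<bar>q\<bar>"
  shows "corr n p 0 p q = 1/2"
proof -
  have nz: "p \<noteq> 0" "q \<noteq> 0" using assms by auto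
  have mem: "- q \<in> sidx n" "- p \<in> sidx n" using assms by auto
  \<comment> \<open>Sign changes and the exchange of \<open>p\<close> with \<open>q\<close> show
    that the four averages are equal.\<close>
  have "corr n p 0 p (- q) = corr n p 0 p q"
    using corr_refl_swap[OF assms(2) mem(1), of p 0 p q] nz assms by (simp add: refl_swap_apply)
  moreover have "corr n q 0 q p = corr n p 0 p q"
    using corr_refl_swap[OF assms(1,2), of p 0 p q] nz assms by (simp add: refl_swap_apply)
  moreover have "corr n q 0 q (- p) = corr n q 0 q p"
    using corr_refl_swap[OF assms(1) mem(2), of q 0 q p] nz assms by (simp add: refl_swap_apply)
  moreover have "corr n p 0 p q + corr n p 0 p (- q) + corr n q 0 q p + corr n q 0 q (- p) = avg n (\<lambda>w. 2)"
    unfolding corr_def avg_add[symmetric]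
  proof (rule avg_cong)
    fix w assume w: "w \<in> signedPerms n"
    have "w p \<noteq> 0" "w q \<noteq> 0" "\<bar>w p\<bar> \<noteq> \<bar>w q\<bar>"
      using nz assms(3) w by (simp_all add: signedPerms_eq_0_iff signedPerms_abs_eq_iff)
    then show "of_int (sgn (w p - w 0) * sgn (w p - w q)) + of_int (sgn (w p - w 0) * sgn (w p - w (- q)))
        + of_int (sgn (w q - w 0) * sgn (w q - w p)) + of_int (sgn (w q - w 0) * sgn (w q - w (- p))) = (2::real)"
      unfolding signedPerms_zero[OF w] signedPerms_odd[OF w] by (simp add: sgn_if) linarith
  qed
  ultimately show ?thesis by (simp add: avg_const)
qed

text \<open>Exchanging \<open>p\<close> and \<open>q\<close> reverses the first sign and fixes the
  second, so the average equals its own negative.\<close>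

lemma corr_orthogonal:
  assumes "p \<in> sidx n" "q \<in> sidx n" "\<bar>r\<bar> \<noteq> \<bar>p\<bar>" "\<bar>r\<bar> \<noteq> \<bar>q\<bar>" "\<bar>s\<bar> \<noteq> \<bar>p\<bar>" "\<bar>s\<bar> \<noteq> \<bar>q\<bar>"
  shows "corr n p q r s = 0"
proof -
  have "p \<noteq> 0" "q \<noteq> 0" using assms by auto
  then have "corr n q p r s = corr n p q r s"
    using corr_refl_swap[OF assms(1,2), of p q r s] assms by (simp add: refl_swap_apply)
  then show ?thesis by (metis corr_neg corr_commute neg_equal_zero)
qed

text \<open>Exchanging \<open>p\<close> and \<open>q\<close> negates e_p - e_q and fixes e_p +
  e_q.\<close>

lemma corr_orthogonal_diff_sum:
  assumes "p \<in> sidx n" "q \<in> sidx n"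
  shows "corr n p q p (- q) = 0"
proof -
  have nz: "p \<noteq> 0" "q \<noteq> 0" using assms by auto
  then have "corr n q p q (- p) = corr n p q p (- q)"
    using corr_refl_swap[OF assms(1,2), of p q p "- q"] assms by (simp add: refl_swap_apply)
  moreover have "corr n q p q (- p) = - corr n p q p (- q)"
    by (metis corr_neg corr_commute corr_uminus minus_minus)
  ultimately show ?thesis by simp
qed

text \<open>The sign change in coordinate \<open>\<bar>p\<bar>\<close> reverses the first factor and
  fixes the second.\<close>

lemma corr_orthogonal_short:
  assumes "p \<in> sidx n" "\<bar>r\<bar> \<noteq> \<bar>p\<bar>" "\<bar>s\<bar> \<noteq> \<bar>p\<bar>"
  shows "corr n p 0 r s = 0"
proof -
  have nz: "p \<noteq> 0" and mem: "- p \<in> sidx n" using assms by auto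
  then have "corr n (- p) 0 r s = corr n p 0 r s"
    using corr_refl_swap[OF assms(1) mem, of p 0 r s] assms by (simp add: refl_swap_apply)
  moreover have "corr n (- p) 0 r s = - corr n p 0 r s"
    by (metis corr_neg corr_commute corr_uminus minus_zero)
  ultimately show ?thesis by simp
qed

text \<open>The reflection in the root itself reverses its sign: a sign change for short roots, an
  exchange of indices for long ones.\<close>

lemma avg_rsgn:
  assumes "(a, b) \<in> rpairs n"
  shows "avg n (\<lambda>w. rsgn w (a, b)) = 0"
proof (cases "b = 0")
  case True
  then have "a \<in> sidx n" "- a \<in> sidx n" "a \<noteq> 0" using assms by (auto simp: rpairs_def)
  then show ?thesis
    by (intro avg_eq_0[of a n "- a"])
       (auto simp: rsgn_def refl_swap_apply signedPerms_odd signedPerms_zero True sgn_if)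
next
  case False
  then have "a \<in> sidx n" "b \<in> sidx n" "a \<noteq> 0" using assms by (auto simp: rpairs_def)
  then show ?thesis
    using False by (intro avg_eq_0[of a n b]) (auto simp: rsgn_def refl_swap_apply sgn_if)
qed

subsection \<open>Correlations as inner products\<close>

text \<open>With separate long and short components, one of which is zero, coefficients that depend
  on root lengths still give a bilinear expression, which can be summed over a set of roots.\<close>

definition long_part :: "int \<times> int \<Rightarrow> nat \<Rightarrow> real" where
  "long_part p k = (if snd p = 0 then 0 else of_int (root_of p k))"

definition short_part :: "int \<times> int \<Rightarrow> nat \<Rightarrow> real" where
  "short_part p k = (if snd p = 0 then of_int (root_of p k) else 0)"

lemma sum_svec_mult:
  assumes "\<bar>x\<bar> \<le> int n"
  shows "(\<Sum>k = 1..n. real_of_int (svec x k) * f k) = of_int (sgn x) * f (nat \<bar>x\<bar>)"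
proof -
  have "(\<Sum>k = 1..n. real_of_int (svec x k) * f k)
      = (\<Sum>k = 1..n. if k = nat \<bar>x\<bar> then of_int (sgn x) * f k else 0)"
    by (intro sum.cong) (auto simp: svec_def unitv_def)
  also have "\<dots> = of_int (sgn x) * f (nat \<bar>x\<bar>)"
    using assms by (cases "x = 0") auto
  finally show ?thesis .
qed

lemma sum_svec_svec:
  assumes "\<bar>x\<bar> \<le> int n"
  shows "(\<Sum>k = 1..n. real_of_int (svec x k) * of_int (svec y k))
    = (if x = 0 then 0 else if x = y then 1 else if x = - y then -1 else 0)"
  unfolding sum_svec_mult[OF assms] by (auto simp: svec_def unitv_def sgn_if)

text \<open>Expands into four products of signed basis vectors. As \<open>a\<close> and
  \<open>c\<close> are positive, only the last product can have both indices 0.\<close>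

lemma sum_root_of_root_of:
  assumes "(a, b) \<in> rpairs n" "(c, d) \<in> rpairs n"
  shows "(\<Sum>k = 1..n. real_of_int (root_of (a, b) k) * of_int (root_of (c, d) k))
    = (if a = c then 1 else 0) - (if a = d then 1 else if a = - d then -1 else 0)
      - (if b = c then 1 else if b = - c then -1 else 0)
      + (if b = 0 then 0 else if b = d then 1 else if b = - d then -1 else 0)"
proof -
  have *: "\<bar>a\<bar> \<le> int n" "\<bar>b\<bar> \<le> int n" "a > 0" "c > 0" using assms by (auto simp: rpairs_def)
  have "(\<Sum>k = 1..n. real_of_int (root_of (a, b) k) * of_int (root_of (c, d) k))
      = (\<Sum>k = 1..n. real_of_int (svec a k) * of_int (svec c k))
        - (\<Sum>k = 1..n. real_of_int (svec a k) * of_int (svec d k))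
        - (\<Sum>k = 1..n. real_of_int (svec b k) * of_int (svec c k))
        + (\<Sum>k = 1..n. real_of_int (svec b k) * of_int (svec d k))"
    by (simp add: root_of_def algebra_simps sum.distrib sum_subtractf)
  moreover have "(\<Sum>k = 1..n. real_of_int (svec a k) * of_int (svec c k)) = (if a = c then 1 else 0)"
    unfolding sum_svec_svec[OF *(1)] using * by auto
  moreover have "(\<Sum>k = 1..n. real_of_int (svec a k) * of_int (svec d k))
      = (if a = d then 1 else if a = - d then -1 else 0)"
    unfolding sum_svec_svec[OF *(1)] using * by auto
  moreover have "(\<Sum>k = 1..n. real_of_int (svec b k) * of_int (svec c k))
      = (if b = c then 1 else if b = - c then -1 else 0)"
    unfolding sum_svec_svec[OF *(2)] using * by auto
  ultimately show ?thesis
    by (simp only: sum_svec_svec[OF *(2)])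
qed

lemma corr_short_short_eq:
  assumes "(a, 0) \<in> rpairs n" "(c, 0) \<in> rpairs n"
  shows "corr n a 0 c 0 = (\<Sum>k = 1..n. real_of_int (root_of (a, 0) k) * of_int (root_of (c, 0) k))"
proof (cases "a = c")
  case True
  then show ?thesis using assms corr_self[of a 0 n] unfolding sum_root_of_root_of[OF assms]
    by (auto simp: rpairs_def)
next
  case False
  then have "corr n a 0 c 0 = 0"
    using assms by (intro corr_orthogonal_short) (auto simp: rpairs_def)
  then show ?thesis using False assms unfolding sum_root_of_root_of[OF assms]
    by (auto simp: rpairs_def)
qed

lemma corr_short_long_eq:
  assumes "(a, 0) \<in> rpairs n" "(c, d) \<in> rpairs n" "d \<noteq> 0"
  shows "corr n a 0 c d = (\<Sum>k = 1..n. real_of_int (root_of (a, 0) k) * of_int (root_of (c, d) k)) / 2"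
proof -
  have *: "a > 0" "\<bar>d\<bar> < c" "a \<in> sidx n" "c \<in> sidx n" "d \<in> sidx n" "- d \<in> sidx n" "- c \<in> sidx n"
    using assms by (auto simp: rpairs_def)
  consider "a = c" "\<bar>a\<bar> \<noteq> \<bar>d\<bar>" | "a = d" "\<bar>a\<bar> \<noteq> \<bar>c\<bar>" | "a = - d" "\<bar>a\<bar> \<noteq> \<bar>c\<bar>" | "\<bar>c\<bar> \<noteq> \<bar>a\<bar>" "\<bar>d\<bar> \<noteq> \<bar>a\<bar>"
    using * by linarith
  then show ?thesis
  proof cases
    case 1
    then have "corr n a 0 c d = 1/2" using * corr_short_long[of a n d] by simp
    then show ?thesis using 1 * assms(3) unfolding sum_root_of_root_of[OF assms(1,2)] by auto
  next
    case 2
    then have "corr n a 0 c d = - 1/2"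
      using * corr_short_long[of a n c] corr_neg[of n a 0 c a] by simp
    then show ?thesis using 2 * assms(3) unfolding sum_root_of_root_of[OF assms(1,2)] by auto
  next
    case 3
    \<comment> \<open>\<open>(c, - a)\<close> is re-encoded as \<open>(a, - c)\<close>, so that
      \<open>a\<close> comes first.\<close>
    then have "corr n a 0 c d = 1/2"
      using * corr_short_long[of a n "- c"] corr_uminus[of n a 0 "- a" c] by simp
    then show ?thesis using 3 * assms(3) unfolding sum_root_of_root_of[OF assms(1,2)] by auto
  next
    case 4
    then have "corr n a 0 c d = 0"
      using * corr_orthogonal_short[of a n c d] by simp
    then show ?thesis using 4 * assms(3) unfolding sum_root_of_root_of[OF assms(1,2)] by auto
  qed
qed

text \<open>Apart from equal or orthogonal roots, two long roots share one index up to sign.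
  \<open>corr_uminus\<close> and reversals, each costing a factor -1, bring it to the front of both
  pairs, where \<open>corr_common_index\<close> applies.\<close>

lemma corr_long_long_eq:
  assumes "(a, b) \<in> rpairs n" "(c, d) \<in> rpairs n" "b \<noteq> 0" "d \<noteq> 0"
  shows "corr n a b c d = (\<Sum>k = 1..n. real_of_int (root_of (a, b) k) * of_int (root_of (c, d) k)) / 3
    + (if (a, b) = (c, d) then 1/3 else 0)"
proof -
  note ip = sum_root_of_root_of[OF assms(1,2)]
  have *: "\<bar>b\<bar> < a" "\<bar>d\<bar> < c"
      and mem: "a \<in> sidx n" "b \<in> sidx n" "c \<in> sidx n" "d \<in> sidx n" "- a \<in> sidx n" "- c \<in> sidx n"
    using assms by (auto simp: rpairs_def)
  have "\<bar>c\<bar> = \<bar>a\<bar> \<longleftrightarrow> a = c" using * by linarith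
  moreover have "\<bar>c\<bar> = \<bar>b\<bar> \<longleftrightarrow> b = c \<or> b = - c" by linarith
  moreover have "\<bar>d\<bar> = \<bar>a\<bar> \<longleftrightarrow> a = d \<or> a = - d" by linarith
  moreover have "\<bar>d\<bar> = \<bar>b\<bar> \<longleftrightarrow> b = d \<or> d = - b" by linarith
  ultimately consider "a = c" "b = d" | "a = c" "d = - b" | "a = c" "\<bar>b\<bar> \<noteq> \<bar>d\<bar>" | "a = d" | "a = - d"
    | "b = c" | "b = - c" | "a \<noteq> c" "b = d" | "a \<noteq> c" "d = - b"
    | "\<bar>c\<bar> \<noteq> \<bar>a\<bar>" "\<bar>c\<bar> \<noteq> \<bar>b\<bar>" "\<bar>d\<bar> \<noteq> \<bar>a\<bar>" "\<bar>d\<bar> \<noteq> \<bar>b\<bar>"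
    by metis
  then show ?thesis
  proof cases
    case 1
    \<comment> \<open>The inner product is 2 here, and 2/3 + 1/3 = 1; hence the extra term for equal
      roots.\<close>
    then show ?thesis using * assms(3) corr_self[of a b n] unfolding ip by auto
  next
    case 2
    then show ?thesis using * assms(3) corr_orthogonal_diff_sum[OF mem(1,2)] unfolding ip by auto
  next
    case 3
    then have "corr n a b c d = 1/3"
      using * corr_common_index[OF mem(1,2,4)] by simp
    then show ?thesis using 3 * assms(3) unfolding ip by auto
  next
    case 4
    have "corr n a b c d = - corr n a b a c"
      using 4 corr_neg[of n a b c a] by simp
    then have "corr n a b c d = - 1/3"
      using 4 * corr_common_index[OF mem(1,2,3)] by simp
    then show ?thesis using 4 * assms(3) unfolding ip by auto
  next
    case 5
    have "corr n a b c d = corr n a b a (- c)"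
      using 5 corr_uminus[of n a b "- a" c] by simp
    then have "corr n a b c d = 1/3"
      using 5 * corr_common_index[OF mem(1,2,6)] by simp
    then show ?thesis using 5 * assms(3) unfolding ip by auto
  next
    case 6
    have "corr n a b c d = - corr n c d c a"
      using 6 corr_neg[of n c d c a] corr_commute[of n a b c d] by simp
    then have "corr n a b c d = - 1/3"
      using 6 * corr_common_index[OF mem(3,4,1)] by simp
    then show ?thesis using 6 * assms(3) unfolding ip by auto
  next
    case 7
    have "corr n a b c d = corr n c d c (- a)"
      using 7 corr_uminus[of n c d "- c" a] corr_commute[of n a b c d] by simp
    then have "corr n a b c d = 1/3"
      using 7 * corr_common_index[OF mem(3,4,5)] by simp
    then show ?thesis using 7 * assms(3) unfolding ip by auto
  next
    case 8
    \<comment> \<open>Both pairs are reversed, and the two signs cancel.\<close>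
    have "corr n a b c d = corr n b c b a"
      using 8 corr_neg[of n a b b c] corr_neg[of n b c a b] corr_commute[of n a b b c] by simp
    then have "corr n a b c d = 1/3"
      using 8 * corr_common_index[OF mem(2,3,1)] by simp
    then show ?thesis using 8 * assms(3) unfolding ip by auto
  next
    case 9
    have "corr n a b c d = - corr n b (- c) b a"
      using 9 corr_uminus[of n a b "- b" c] corr_commute[of n a b b "- c"] corr_neg[of n b "- c" b a] by simp
    then have "corr n a b c d = - 1/3"
      using 9 * corr_common_index[OF mem(2,6,1)] by simp
    then show ?thesis using 9 * assms(3) unfolding ip by auto
  next
    case 10
    then have "corr n a b c d = 0" by (intro corr_orthogonal mem)
    moreover have "a \<noteq> c" "a \<noteq> d" "a \<noteq> - d" "b \<noteq> c" "b \<noteq> - c" "b \<noteq> d" "b \<noteq> - d"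
      using 10 by auto
    ultimately show ?thesis unfolding ip by simp
  qed
qed

text \<open>For given lengths only one of the four sums can be nonzero, so the cases merge into one
  expression that is bilinear apart from its diagonal term.\<close>

lemma corr_eq_inner_products:
  assumes "p \<in> rpairs n" "q \<in> rpairs n"
  shows "avg n (\<lambda>w. rsgn w p * rsgn w q) =
    (\<Sum>k = 1..n. long_part p k * long_part q k) / 3
    + ((\<Sum>k = 1..n. long_part p k * short_part q k) + (\<Sum>k = 1..n. short_part p k * long_part q k)) / 2
    + (\<Sum>k = 1..n. short_part p k * short_part q k)
    + (if p = q \<and> snd p \<noteq> 0 then 1/3 else 0)"
proof -
  obtain a b c d where pq: "p = (a, b)" "q = (c, d)" by fastforce
  consider "b = 0" "d = 0" | "b = 0" "d \<noteq> 0" | "b \<noteq> 0" "d = 0" | "b \<noteq> 0" "d \<noteq> 0" by blast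
  then show ?thesis
  proof cases
    case 1
    then show ?thesis using assms corr_short_short_eq[of a n c]
      by (simp add: pq avg_rsgn_mult long_part_def short_part_def)
  next
    case 2
    then show ?thesis using assms corr_short_long_eq[of a n c d]
      by (simp add: pq avg_rsgn_mult long_part_def short_part_def)
  next
    case 3
    then show ?thesis using assms corr_short_long_eq[of c n a b]
      by (simp add: pq avg_rsgn_mult long_part_def short_part_def corr_commute[of n a b] mult.commute)
  next
    case 4
    then show ?thesis using assms corr_long_long_eq[of a b n c d]
      by (simp add: pq avg_rsgn_mult long_part_def short_part_def)
  qed
qed

text \<open>The centred variable is -1/2 times the sum of signs. Its square averages to a quarter of
  the double sum of correlations, and bilinearity moves both sums over roots inside the sum over
  coordinates; the diagonal terms count the long roots.\<close>

lemma VarB_root_of: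
  assumes "P \<subseteq> rpairs n"
  defines "v \<equiv> \<lambda>k. \<Sum>p\<in>P. long_part p k" and "u \<equiv> \<lambda>k. \<Sum>p\<in>P. short_part p k"
  shows "VarB n (root_of ` P) =
    ((\<Sum>k = 1..n. v k ^ 2 / 3 + v k * u k + u k ^ 2) + real (card {p \<in> P. snd p \<noteq> 0}) / 3) / 4"
proof -
  have fin: "finite P" using assms(1) finite_rpairs finite_subset by blast
  have X: "Xset n (root_of ` P) w = real (card P) / 2 + (- 1/2) * (\<Sum>p\<in>P. rsgn w p)"
    if "w \<in> signedPerms n" for w
    using Xset_root_of[OF that assms(1)] by simp
  have mean: "avg n (Xset n (root_of ` P)) = real (card P) / 2"
  proof -
    have "avg n (\<lambda>w. \<Sum>p\<in>P. rsgn w p) = 0"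
      unfolding avg_sum using assms(1) avg_rsgn by (intro sum.neutral) auto
    then have "avg n (\<lambda>w. real (card P) / 2 + (- 1/2) * (\<Sum>p\<in>P. rsgn w p)) = real (card P) / 2"
      unfolding avg_add avg_const avg_cmult by simp
    then show ?thesis using avg_cong[OF X] by simp
  qed
  have "VarB n (root_of ` P) = avg n (\<lambda>w. (Xset n (root_of ` P) w - real (card P) / 2) ^ 2)"
    by (simp add: VarB_def expectation_eq_avg mean)
  also have "\<dots> = avg n (\<lambda>w. (1/4) * (\<Sum>p\<in>P. \<Sum>q\<in>P. rsgn w p * rsgn w q))"
    by (rule avg_cong) (simp add: X power2_eq_square sum_product)
  also have "\<dots> = (\<Sum>p\<in>P. \<Sum>q\<in>P. avg n (\<lambda>w. rsgn w p * rsgn w q)) / 4"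
    unfolding avg_cmult avg_sum by simp
  also have "(\<Sum>p\<in>P. \<Sum>q\<in>P. avg n (\<lambda>w. rsgn w p * rsgn w q)) =
    (\<Sum>p\<in>P. \<Sum>q\<in>P. (\<Sum>k = 1..n. long_part p k * long_part q k) / 3
    + ((\<Sum>k = 1..n. long_part p k * short_part q k) + (\<Sum>k = 1..n. short_part p k * long_part q k)) / 2
    + (\<Sum>k = 1..n. short_part p k * short_part q k)
    + (if p = q \<and> snd p \<noteq> 0 then 1/3 else 0))"
    using assms(1) by (intro sum.cong refl corr_eq_inner_products) auto
  also have "\<dots> = (\<Sum>k = 1..n. v k * v k) / 3
    + ((\<Sum>k = 1..n. v k * u k) + (\<Sum>k = 1..n. u k * v k)) / 2 + (\<Sum>k = 1..n. u k * u k)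
    + (\<Sum>p\<in>P. \<Sum>q\<in>P. if p = q \<and> snd p \<noteq> 0 then 1/3 else 0)"
  proof -
    have bil: "(\<Sum>p\<in>P. \<Sum>q\<in>P. \<Sum>k = 1..n. f p k * g q k) = (\<Sum>k = 1..n. (\<Sum>p\<in>P. f p k) * (\<Sum>q\<in>P. g q k))"
      for f g :: "int \<times> int \<Rightarrow> nat \<Rightarrow> real"
    proof -
      have "(\<Sum>k = 1..n. (\<Sum>p\<in>P. f p k) * (\<Sum>q\<in>P. g q k)) = (\<Sum>k = 1..n. \<Sum>p\<in>P. \<Sum>q\<in>P. f p k * g q k)"
        by (simp add: sum_product)
      also have "\<dots> = (\<Sum>p\<in>P. \<Sum>k = 1..n. \<Sum>q\<in>P. f p k * g q k)"
        by (rule sum.swap)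
      also have "\<dots> = (\<Sum>p\<in>P. \<Sum>q\<in>P. \<Sum>k = 1..n. f p k * g q k)"
        by (intro sum.cong refl sum.swap)
      finally show ?thesis by simp
    qed
    show ?thesis
      by (simp only: sum.distrib sum_divide_distrib[symmetric] bil v_def u_def)
  qed
  also have "(\<Sum>p\<in>P. \<Sum>q\<in>P. if p = q \<and> snd p \<noteq> 0 then 1/3 else (0::real))
      = real (card {p \<in> P. snd p \<noteq> 0}) / 3"
  proof -
    have "(\<Sum>p\<in>P. \<Sum>q\<in>P. if p = q \<and> snd p \<noteq> 0 then 1/3 else (0::real))
        = (\<Sum>p\<in>P. if snd p \<noteq> 0 then 1/3 else 0)"
    proof (rule sum.cong[OF refl])
      fix p assume "p \<in> P"
      then show "(\<Sum>q\<in>P. if p = q \<and> snd p \<noteq> 0 then 1/3 else (0::real)) = (if snd p \<noteq> 0 then 1/3 else 0)"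
        using fin by (cases "snd p = 0") auto
    qed
    also have "\<dots> = real (card {p \<in> P. snd p \<noteq> 0}) / 3"
      using fin by (simp add: sum.inter_filter[symmetric])
    finally show ?thesis .
  qed
  finally show ?thesis
    by (simp add: sum.distrib sum_divide_distrib[symmetric] power2_eq_square mult.commute)
qed

subsection \<open>The variance as a single sum over coordinates\<close>

lemma card_eq_sum_of_bool:
  "finite P \<Longrightarrow> real (card {p \<in> P. Q p}) = (\<Sum>p\<in>P. of_bool (Q p))"
  by (simp add: of_bool_def sum.inter_filter[symmetric])

text \<open>\<open>A\<close> spreads the number of long roots over the coordinates, so that the
  variance becomes one sum; integer values let integer arithmetic identify the linear
  pieces.\<close>

definition summand :: "(nat \<Rightarrow> int) \<Rightarrow> (nat \<Rightarrow> int) \<Rightarrow> (nat \<Rightarrow> int) \<Rightarrow> nat \<Rightarrow> real" where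
  "summand A V U k = (of_int (V k) ^ 2 + of_int (A k)) / 3 + of_int (V k) * of_int (U k) + of_int (U k) ^ 2"

text \<open>Coordinate \<open>k\<close> of the sum of the long roots receives +1 from first
  component \<open>k\<close> and second component \<open>- k\<close>, and -1 from second component
  \<open>k\<close>. \<open>A\<close> counts each long root at its first component.\<close>

lemma VarB_eq_sum:
  fixes A V U :: "nat \<Rightarrow> int"
  assumes P: "P \<subseteq> rpairs n"
    and A: "\<And>k. k \<in> {1..n} \<Longrightarrow> A k = int (card {p \<in> P. fst p = int k \<and> snd p \<noteq> 0})"
    and V: "\<And>k. k \<in> {1..n} \<Longrightarrow>
      V k = A k - int (card {p \<in> P. snd p = int k}) + int (card {p \<in> P. snd p = - int k})"
    and U: "\<And>k. k \<in> {1..n} \<Longrightarrow> U k = of_bool ((int k, 0) \<in> P)"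
  shows "VarB n (root_of ` P) = sum (summand A V U) {0<..n} / 4"
proof -
  have fin: "finite P" using P finite_rpairs finite_subset by blast
  have v: "(\<Sum>p\<in>P. long_part p k) = of_int (V k)" if k: "k \<in> {1..n}" for k
  proof -
    have "(\<Sum>p\<in>P. long_part p k) = (\<Sum>p\<in>P. of_bool (fst p = int k \<and> snd p \<noteq> 0)
        - of_bool (snd p = int k) + of_bool (snd p = - int k))"
    proof (rule sum.cong[OF refl])
      fix p assume "p \<in> P"
      then obtain a b where "p = (a, b)" "\<bar>b\<bar> < a" using P by (auto simp: rpairs_def)
      then show "long_part p k = of_bool (fst p = int k \<and> snd p \<noteq> 0)
          - of_bool (snd p = int k) + of_bool (snd p = - int k)"
        using k by (simp add: long_part_def root_of_def svec_apply)
    qed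
    also have "\<dots> = of_int (V k)"
      using k by (simp add: sum.distrib sum_subtractf V A card_eq_sum_of_bool[OF fin])
    finally show ?thesis .
  qed
  have u: "(\<Sum>p\<in>P. short_part p k) = of_int (U k)" if k: "k \<in> {1..n}" for k
  proof -
    have "(\<Sum>p\<in>P. short_part p k) = (\<Sum>p\<in>P. if p = (int k, 0) then 1 else 0)"
    proof (rule sum.cong[OF refl])
      fix p assume "p \<in> P"
      then obtain a b where "p = (a, b)" "\<bar>b\<bar> < a" using P by (auto simp: rpairs_def)
      then show "short_part p k = (if p = (int k, 0) then 1 else 0)"
        using k by (auto simp: short_part_def root_of_def svec_apply)
    qed
    also have "\<dots> = of_int (U k)"
      using k fin by (simp add: U)
    finally show ?thesis .
  qed
  have "real (card {p \<in> P. snd p \<noteq> 0}) = (\<Sum>k = 1..n. of_int (A k))"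
  proof -
    have "{p \<in> P. snd p \<noteq> 0} = (\<Union>k\<in>{1..n}. {p \<in> P. fst p = int k \<and> snd p \<noteq> 0})" (is "?L = ?R")
    proof
      show "?L \<subseteq> ?R"
      proof
        fix p assume p: "p \<in> ?L"
        then have "nat (fst p) \<in> {1..n}" "fst p = int (nat (fst p))"
          using P by (auto simp: rpairs_def)
        then show "p \<in> ?R" using p by blast
      qed
    qed auto
    then have "card {p \<in> P. snd p \<noteq> 0} = (\<Sum>k = 1..n. card {p \<in> P. fst p = int k \<and> snd p \<noteq> 0})"
      using fin by (simp only:) (rule card_UN_disjoint, auto)
    then show ?thesis using A by simp
  qed
  moreover have "{1..n} = {0<..n}" by auto
  ultimately show ?thesis
    using v u by (simp add: VarB_root_of[OF P] summand_def sum.distrib sum_divide_distrib[symmetric] add_divide_distrib)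
qed

text \<open>Indefinite sum of \<^term>\<open>summand A V U\<close> for \<open>A k = a\<^sub>0 + a\<^sub>1 k\<close>, \<open>V k = v\<^sub>0 + v\<^sub>1 k\<close> and
  \<open>U k = u\<close>.\<close>

definition indef_sum :: "int \<Rightarrow> int \<Rightarrow> int \<Rightarrow> int \<Rightarrow> int \<Rightarrow> real \<Rightarrow> real" where
  "indef_sum a0 a1 v0 v1 u x =
     ((of_int v0 ^ 2 + of_int a0) / 3 + of_int v0 * of_int u + of_int u ^ 2) * x
     + ((2 * of_int v0 * of_int v1 + of_int a1) / 3 + of_int v1 * of_int u) * (x * (x + 1) / 2)
     + of_int v1 ^ 2 / 3 * (x * (x + 1) * (2 * x + 1) / 6)"

text \<open>The increment of \<open>indef_sum\<close> from \<open>k - 1\<close> to \<open>k\<close>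
  is the summand. Empty pieces are allowed, so breakpoints may coincide.\<close>

lemma sum_eq_indef_sum:
  fixes A V U :: "nat \<Rightarrow> int"
  assumes "a \<le> b"
    and "\<And>k. a < k \<Longrightarrow> k \<le> b \<Longrightarrow> A k = a0 + a1 * int k \<and> V k = v0 + v1 * int k \<and> U k = u"
  shows "sum (summand A V U) {a<..b}
    = indef_sum a0 a1 v0 v1 u (real b) - indef_sum a0 a1 v0 v1 u (real a)"
  using assms
proof (induction b rule: dec_induct)
  case (step b)
  have "{a<..Suc b} = insert (Suc b) {a<..b}" using step by auto
  then show ?case
    using step by (simp add: indef_sum_def summand_def) (simp add: field_simps power2_eq_square)
qed auto

lemma sum_greaterThanAtMost_split:
  fixes f :: "nat \<Rightarrow> real"
  assumes "a \<le> b" "b \<le> c"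
  shows "sum f {a<..c} = sum f {a<..b} + sum f {b<..c}"
  using assms by (subst sum.union_disjoint[symmetric]) (auto intro!: sum.cong)

subsection \<open>Roots of fixed height\<close>

definition eq_pairs :: "nat \<Rightarrow> nat \<Rightarrow> (int \<times> int) set" where
  "eq_pairs n d = {p \<in> rpairs n. fst p - snd p = int d}"

lemma posRootsEq_eq: "posRootsEq n d = root_of ` eq_pairs n d"
  by (auto simp: posRootsEq_def posRootsB_eq eq_pairs_def htB_root_of)

text \<open>The only candidate with first component \<open>k\<close> is \<open>(k, k - d)\<close>;
  it is a positive root if \<open>d < 2 * k\<close>, and short if \<open>k = d\<close>.\<close>

definition eqA :: "nat \<Rightarrow> nat \<Rightarrow> nat \<Rightarrow> int" where
  "eqA n d k = of_bool (d < 2 * k \<and> k \<noteq> d)"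

text \<open>Second component \<open>k\<close> occurs only in \<open>(k + d, k)\<close> and
  \<open>- k\<close> only in \<open>(d - k, - k)\<close>; the last two conditions place these pairs
  in \<open>rpairs n\<close>.\<close>

definition eqV :: "nat \<Rightarrow> nat \<Rightarrow> nat \<Rightarrow> int" where
  "eqV n d k = eqA n d k - of_bool (k + d \<le> n) + of_bool (2 * k < d \<and> d \<le> n + k)"

definition eqU :: "nat \<Rightarrow> nat \<Rightarrow> nat \<Rightarrow> int" where
  "eqU n d k = of_bool (k = d)"

lemma VarB_posRootsEq:
  assumes "1 \<le> d"
  shows "VarB n (posRootsEq n d) = sum (summand (eqA n d) (eqV n d) (eqU n d)) {0<..n} / 4"
  unfolding posRootsEq_eq
proof (rule VarB_eq_sum)
  show "eq_pairs n d \<subseteq> rpairs n" by (auto simp: eq_pairs_def)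
next
  fix k assume k: "k \<in> {1..n}"
  have "{p \<in> eq_pairs n d. fst p = int k \<and> snd p \<noteq> 0}
      = (if d < 2 * k \<and> k \<noteq> d then {(int k, int k - int d)} else {})"
    using assms k by (auto simp: eq_pairs_def rpairs_def)
  then show "eqA n d k = int (card {p \<in> eq_pairs n d. fst p = int k \<and> snd p \<noteq> 0})"
    by (simp add: eqA_def)
next
  fix k assume k: "k \<in> {1..n}"
  have "{p \<in> eq_pairs n d. snd p = int k} = (if k + d \<le> n then {(int k + int d, int k)} else {})"
    using assms k by (auto simp: eq_pairs_def rpairs_def)
  moreover have "{p \<in> eq_pairs n d. snd p = - int k}
      = (if 2 * k < d \<and> d \<le> n + k then {(int d - int k, - int k)} else {})"
    using assms k by (auto simp: eq_pairs_def rpairs_def)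
  ultimately show "eqV n d k = eqA n d k - int (card {p \<in> eq_pairs n d. snd p = int k})
      + int (card {p \<in> eq_pairs n d. snd p = - int k})"
    by (simp add: eqV_def)
next
  fix k assume k: "k \<in> {1..n}"
  then show "eqU n d k = of_bool ((int k, 0) \<in> eq_pairs n d)"
    by (auto simp: eqU_def eq_pairs_def rpairs_def)
qed

subsection \<open>Roots of bounded height\<close>

definition le_pairs :: "nat \<Rightarrow> nat \<Rightarrow> (int \<times> int) set" where
  "le_pairs n d = {p \<in> rpairs n. fst p - snd p \<le> int d}"

lemma posRootsLe_eq: "posRootsLe n d = root_of ` le_pairs n d"
  by (auto simp: posRootsLe_def posRootsB_eq le_pairs_def htB_root_of)

text \<open>The second component runs from \<open>max (1 - k) (k - d)\<close> to
  \<open>k - 1\<close>; the value 0 is removed, as it gives a short root.\<close>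

definition leA :: "nat \<Rightarrow> nat \<Rightarrow> nat \<Rightarrow> int" where
  "leA n d k = min (2 * int k - 1) (int d) - of_bool (k \<le> d)"

text \<open>First components paired with \<open>k\<close> run from \<open>k + 1\<close> to
  \<open>min n (k + d)\<close>, those paired with \<open>- k\<close> from \<open>k + 1\<close> to
  \<open>min n (d - k)\<close>; the latter range may be empty, hence \<open>max 0\<close>.\<close>

definition leV :: "nat \<Rightarrow> nat \<Rightarrow> nat \<Rightarrow> int" where
  "leV n d k = leA n d k - (min (int n) (int k + int d) - int k)
     + max 0 (min (int n) (int d - int k) - int k)"

definition leU :: "nat \<Rightarrow> nat \<Rightarrow> nat \<Rightarrow> int" where
  "leU n d k = of_bool (k \<le> d)"

lemma VarB_posRootsLe:
  assumes "1 \<le> d"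
  shows "VarB n (posRootsLe n d) = sum (summand (leA n d) (leV n d) (leU n d)) {0<..n} / 4"
  unfolding posRootsLe_eq
proof (rule VarB_eq_sum)
  show "le_pairs n d \<subseteq> rpairs n" by (auto simp: le_pairs_def)
next
  fix k assume k: "k \<in> {1..n}"
  let ?I = "{max (1 - int k) (int k - int d)..int k - 1}"
  have "{p \<in> le_pairs n d. fst p = int k \<and> snd p \<noteq> 0} = Pair (int k) ` (?I - {0})"
    using k by (auto simp: le_pairs_def rpairs_def image_iff)
  then have "card {p \<in> le_pairs n d. fst p = int k \<and> snd p \<noteq> 0} = card (?I - {0})"
    by (simp add: card_image inj_on_def)
  also have "int (card (?I - {0})) = int (card ?I) - of_bool (k \<le> d)"
    using k assms by (auto simp: card_Diff_singleton_if of_nat_diff)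
  also have "int (card ?I) = min (2 * int k - 1) (int d)"
    using k assms by auto
  finally show "leA n d k = int (card {p \<in> le_pairs n d. fst p = int k \<and> snd p \<noteq> 0})"
    by (simp add: leA_def)
next
  fix k assume k: "k \<in> {1..n}"
  have "{p \<in> le_pairs n d. snd p = int k} = (\<lambda>a. (a, int k)) ` {int k + 1..min (int n) (int k + int d)}"
    using k by (auto simp: le_pairs_def rpairs_def image_iff)
  then have "card {p \<in> le_pairs n d. snd p = int k} = card {int k + 1..min (int n) (int k + int d)}"
    by (simp add: card_image inj_on_def)
  also have "int \<dots> = min (int n) (int k + int d) - int k"
    using k by auto
  finally have 1: "int (card {p \<in> le_pairs n d. snd p = int k}) = min (int n) (int k + int d) - int k" .
  have "{p \<in> le_pairs n d. snd p = - int k} = (\<lambda>a. (a, - int k)) ` {int k + 1..min (int n) (int d - int k)}"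
    using k by (auto simp: le_pairs_def rpairs_def image_iff)
  then have "card {p \<in> le_pairs n d. snd p = - int k} = card {int k + 1..min (int n) (int d - int k)}"
    by (simp add: card_image inj_on_def)
  also have "int \<dots> = max 0 (min (int n) (int d - int k) - int k)"
    by auto
  finally have 2: "int (card {p \<in> le_pairs n d. snd p = - int k}) = max 0 (min (int n) (int d - int k) - int k)" .
  show "leV n d k = leA n d k - int (card {p \<in> le_pairs n d. snd p = int k})
      + int (card {p \<in> le_pairs n d. snd p = - int k})"
    by (simp only: leV_def 1 2)
next
  fix k assume k: "k \<in> {1..n}"
  then show "leU n d k = of_bool ((int k, 0) \<in> le_pairs n d)"
    by (auto simp: leU_def le_pairs_def rpairs_def)
qed

subsection \<open>Evaluation\<close>

text \<open>The breakpoints are, in order, \<open>g\<close>, \<open>h\<close>, \<open>d - 1\<close>,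
  \<open>d\<close> and \<open>n - d\<close>; the piece from \<open>d - 1\<close> to \<open>d\<close>
  is the index of the short root.\<close>

lemma VarB_posRootsEq_le_half:
  assumes "1 \<le> d" "2 * d \<le> n"
  shows "VarB n (posRootsEq n d) = real d / 24 + real n / 12 + (if even d then 1/12 else 1/24)"
proof -
  let ?F = "summand (eqA n d) (eqV n d) (eqU n d)"
  define h where "h = d div 2"
  have h: "2 * h \<le> d" "d \<le> 2 * h + 1" by (auto simp: h_def)
  have hr: "real h = (real d - of_bool (odd d)) / 2" by (auto simp: h_def elim!: evenE oddE)
  \<comment> \<open>\<open>{g<..h}\<close> holds the index with \<open>2 * k = d\<close> if
    \<open>d\<close> is even and is empty otherwise. It is a separate piece since neither
    \<open>d < 2 * k\<close> nor \<open>2 * k < d\<close> holds there.\<close>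
  define g where "g = (d - 1) div 2"
  have g: "2 * g < d" "d \<le> 2 * g + 2" "g \<le> h" using assms(1) by (auto simp: g_def h_def)
  have gr: "real g = (real d - 1 - of_bool (even d)) / 2"
    using assms(1) by (cases d) (auto simp: g_def elim!: evenE oddE)
  have s0: "sum ?F {0<..g} = indef_sum 0 0 0 0 0 (real g) - indef_sum 0 0 0 0 0 (real 0)"
    by (rule sum_eq_indef_sum) (use assms g h in \<open>auto simp: eqA_def eqV_def eqU_def\<close>)
  have s1: "sum ?F {g<..h} = indef_sum 0 0 (-1) 0 0 (real h) - indef_sum 0 0 (-1) 0 0 (real g)"
    by (rule sum_eq_indef_sum) (use assms g h in \<open>auto simp: eqA_def eqV_def eqU_def\<close>)
  have s2: "sum ?F {h<..d - 1} = indef_sum 1 0 0 0 0 (real (d - 1)) - indef_sum 1 0 0 0 0 (real h)"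
    by (rule sum_eq_indef_sum) (use assms g h in \<open>auto simp: eqA_def eqV_def eqU_def\<close>)
  have s3: "sum ?F {d - 1<..d} = indef_sum 0 0 (-1) 0 1 (real d) - indef_sum 0 0 (-1) 0 1 (real (d - 1))"
    by (rule sum_eq_indef_sum) (use assms g h in \<open>auto simp: eqA_def eqV_def eqU_def\<close>)
  have s4: "sum ?F {d<..n - d} = indef_sum 1 0 0 0 0 (real (n - d)) - indef_sum 1 0 0 0 0 (real d)"
    by (rule sum_eq_indef_sum) (use assms g h in \<open>auto simp: eqA_def eqV_def eqU_def\<close>)
  have s5: "sum ?F {n - d<..n} = indef_sum 1 0 1 0 0 (real n) - indef_sum 1 0 1 0 0 (real (n - d))"
    by (rule sum_eq_indef_sum) (use assms g h in \<open>auto simp: eqA_def eqV_def eqU_def\<close>)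
  have "sum ?F {0<..n} = sum ?F {0<..g} + sum ?F {g<..h} + sum ?F {h<..d - 1} + sum ?F {d - 1<..d} + sum ?F {d<..n - d} + sum ?F {n - d<..n}"
    using assms g h by (simp add: sum_greaterThanAtMost_split[symmetric])
  \<comment> \<open>Each parity of \<open>d\<close> leaves a polynomial identity in \<open>d\<close>
    and \<open>n\<close>.\<close>
  then show ?thesis
    unfolding VarB_posRootsEq[OF assms(1)] s0 s1 s2 s3 s4 s5
    using assms by (cases "even d")
      (simp_all add: indef_sum_def gr hr of_nat_diff field_simps power2_eq_square power3_eq_cube)
qed

text \<open>Now \<open>n - d\<close> lies between \<open>h\<close> and \<open>d - 1\<close>. The
  index \<open>k = d\<close> no longer satisfies \<open>k + d \<le> n\<close>, so its long
  coordinate is 0 instead of -1.\<close>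

lemma VarB_posRootsEq_le_two_thirds:
  assumes "1 \<le> d" "n < 2 * d" "3 * d \<le> 2 * n"
  shows "VarB n (posRootsEq n d) = real d / 24 + real n / 12 + (if even d then 1/6 else 1/8)"
proof -
  let ?F = "summand (eqA n d) (eqV n d) (eqU n d)"
  define h where "h = d div 2"
  have h: "2 * h \<le> d" "d \<le> 2 * h + 1" by (auto simp: h_def)
  have hr: "real h = (real d - of_bool (odd d)) / 2" by (auto simp: h_def elim!: evenE oddE)
  define g where "g = (d - 1) div 2"
  have g: "2 * g < d" "d \<le> 2 * g + 2" "g \<le> h" using assms(1) by (auto simp: g_def h_def)
  have gr: "real g = (real d - 1 - of_bool (even d)) / 2"
    using assms(1) by (cases d) (auto simp: g_def elim!: evenE oddE)
  have s0: "sum ?F {0<..g} = indef_sum 0 0 0 0 0 (real g) - indef_sum 0 0 0 0 0 (real 0)"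
    by (rule sum_eq_indef_sum) (use assms g h in \<open>auto simp: eqA_def eqV_def eqU_def\<close>)
  have s1: "sum ?F {g<..h} = indef_sum 0 0 (-1) 0 0 (real h) - indef_sum 0 0 (-1) 0 0 (real g)"
    by (rule sum_eq_indef_sum) (use assms g h in \<open>auto simp: eqA_def eqV_def eqU_def\<close>)
  have s2: "sum ?F {h<..n - d} = indef_sum 1 0 0 0 0 (real (n - d)) - indef_sum 1 0 0 0 0 (real h)"
    by (rule sum_eq_indef_sum) (use assms g h in \<open>auto simp: eqA_def eqV_def eqU_def\<close>)
  have s3: "sum ?F {n - d<..d - 1} = indef_sum 1 0 1 0 0 (real (d - 1)) - indef_sum 1 0 1 0 0 (real (n - d))"
    by (rule sum_eq_indef_sum) (use assms g h in \<open>auto simp: eqA_def eqV_def eqU_def\<close>)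
  have s4: "sum ?F {d - 1<..d} = indef_sum 0 0 0 0 1 (real d) - indef_sum 0 0 0 0 1 (real (d - 1))"
    by (rule sum_eq_indef_sum) (use assms g h in \<open>auto simp: eqA_def eqV_def eqU_def\<close>)
  have s5: "sum ?F {d<..n} = indef_sum 1 0 1 0 0 (real n) - indef_sum 1 0 1 0 0 (real d)"
    by (rule sum_eq_indef_sum) (use assms g h in \<open>auto simp: eqA_def eqV_def eqU_def\<close>)
  have "sum ?F {0<..n} = sum ?F {0<..g} + sum ?F {g<..h} + sum ?F {h<..n - d} + sum ?F {n - d<..d - 1} + sum ?F {d - 1<..d} + sum ?F {d<..n}"
    using assms g h by (simp add: sum_greaterThanAtMost_split[symmetric])
  then show ?thesis
    unfolding VarB_posRootsEq[OF assms(1)] s0 s1 s2 s3 s4 s5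
    using assms by (cases "even d")
      (simp_all add: indef_sum_def gr hr of_nat_diff field_simps power2_eq_square power3_eq_cube)
qed

text \<open>Now \<open>n - d \<le> g\<close>. The bound is strict because
  \<open>2 * n = 3 * d\<close> makes \<open>d\<close> even with middle index
  \<open>d / 2 = n - d\<close>, which still satisfies \<open>k + d \<le> n\<close> and belongs to
  the previous case.\<close>

lemma VarB_posRootsEq_le_n:
  assumes "1 \<le> d" "2 * n < 3 * d" "d \<le> n"
  shows "VarB n (posRootsEq n d) = real d / 24 + real n / 12 + (if even d then 0 else 1/8)"
proof -
  let ?F = "summand (eqA n d) (eqV n d) (eqU n d)"
  define h where "h = d div 2"
  have h: "2 * h \<le> d" "d \<le> 2 * h + 1" by (auto simp: h_def)
  have hr: "real h = (real d - of_bool (odd d)) / 2" by (auto simp: h_def elim!: evenE oddE)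
  define g where "g = (d - 1) div 2"
  have g: "2 * g < d" "d \<le> 2 * g + 2" "g \<le> h" using assms(1) by (auto simp: g_def h_def)
  have gr: "real g = (real d - 1 - of_bool (even d)) / 2"
    using assms(1) by (cases d) (auto simp: g_def elim!: evenE oddE)
  have s0: "sum ?F {0<..n - d} = indef_sum 0 0 0 0 0 (real (n - d)) - indef_sum 0 0 0 0 0 (real 0)"
    by (rule sum_eq_indef_sum) (use assms g h in \<open>auto simp: eqA_def eqV_def eqU_def\<close>)
  have s1: "sum ?F {n - d<..g} = indef_sum 0 0 1 0 0 (real g) - indef_sum 0 0 1 0 0 (real (n - d))"
    by (rule sum_eq_indef_sum) (use assms g h in \<open>auto simp: eqA_def eqV_def eqU_def\<close>)
  have s2: "sum ?F {g<..h} = indef_sum 0 0 0 0 0 (real h) - indef_sum 0 0 0 0 0 (real g)"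
    by (rule sum_eq_indef_sum) (use assms g h in \<open>auto simp: eqA_def eqV_def eqU_def\<close>)
  have s3: "sum ?F {h<..d - 1} = indef_sum 1 0 1 0 0 (real (d - 1)) - indef_sum 1 0 1 0 0 (real h)"
    by (rule sum_eq_indef_sum) (use assms g h in \<open>auto simp: eqA_def eqV_def eqU_def\<close>)
  have s4: "sum ?F {d - 1<..d} = indef_sum 0 0 0 0 1 (real d) - indef_sum 0 0 0 0 1 (real (d - 1))"
    by (rule sum_eq_indef_sum) (use assms g h in \<open>auto simp: eqA_def eqV_def eqU_def\<close>)
  have s5: "sum ?F {d<..n} = indef_sum 1 0 1 0 0 (real n) - indef_sum 1 0 1 0 0 (real d)"
    by (rule sum_eq_indef_sum) (use assms g h in \<open>auto simp: eqA_def eqV_def eqU_def\<close>)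
  have "sum ?F {0<..n} = sum ?F {0<..n - d} + sum ?F {n - d<..g} + sum ?F {g<..h} + sum ?F {h<..d - 1} + sum ?F {d - 1<..d} + sum ?F {d<..n}"
    using assms g h by (simp add: sum_greaterThanAtMost_split[symmetric])
  then show ?thesis
    unfolding VarB_posRootsEq[OF assms(1)] s0 s1 s2 s3 s4 s5
    using assms by (cases "even d")
      (simp_all add: indef_sum_def gr hr of_nat_diff field_simps power2_eq_square power3_eq_cube)
qed

text \<open>Only roots of the form e_j + e_i have height above \<open>n\<close>, so short
  coordinates vanish.\<close>

lemma VarB_posRootsEq_gt_n:
  assumes "1 \<le> d" "n < d" "d \<le> 2 * n - 1"
  shows "VarB n (posRootsEq n d) = - real d / 8 + real n / 4 + (if even d then 0 else 1/8)"
proof -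
  let ?F = "summand (eqA n d) (eqV n d) (eqU n d)"
  define h where "h = d div 2"
  have h: "2 * h \<le> d" "d \<le> 2 * h + 1" by (auto simp: h_def)
  have hr: "real h = (real d - of_bool (odd d)) / 2" by (auto simp: h_def elim!: evenE oddE)
  define g where "g = (d - 1) div 2"
  have g: "2 * g < d" "d \<le> 2 * g + 2" "g \<le> h" using assms(1) by (auto simp: g_def h_def)
  have gr: "real g = (real d - 1 - of_bool (even d)) / 2"
    using assms(1) by (cases d) (auto simp: g_def elim!: evenE oddE)
  \<comment> \<open>The first index with \<open>d \<le> n + k\<close> is \<open>d - n\<close>, so
    the empty range of roots ends one before it.\<close>
  have s0: "sum ?F {0<..d - Suc n} = indef_sum 0 0 0 0 0 (real (d - Suc n)) - indef_sum 0 0 0 0 0 (real 0)"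
    by (rule sum_eq_indef_sum) (use assms g h in \<open>auto simp: eqA_def eqV_def eqU_def\<close>)
  have s1: "sum ?F {d - Suc n<..g} = indef_sum 0 0 1 0 0 (real g) - indef_sum 0 0 1 0 0 (real (d - Suc n))"
    by (rule sum_eq_indef_sum) (use assms g h in \<open>auto simp: eqA_def eqV_def eqU_def\<close>)
  have s2: "sum ?F {g<..h} = indef_sum 0 0 0 0 0 (real h) - indef_sum 0 0 0 0 0 (real g)"
    by (rule sum_eq_indef_sum) (use assms g h in \<open>auto simp: eqA_def eqV_def eqU_def\<close>)
  have s3: "sum ?F {h<..n} = indef_sum 1 0 1 0 0 (real n) - indef_sum 1 0 1 0 0 (real h)"
    by (rule sum_eq_indef_sum) (use assms g h in \<open>auto simp: eqA_def eqV_def eqU_def\<close>)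
  have "sum ?F {0<..n} = sum ?F {0<..d - Suc n} + sum ?F {d - Suc n<..g} + sum ?F {g<..h} + sum ?F {h<..n}"
    using assms g h by (simp add: sum_greaterThanAtMost_split[symmetric])
  then show ?thesis
    unfolding VarB_posRootsEq[OF assms(1)] s0 s1 s2 s3
    using assms by (cases "even d")
      (simp_all add: indef_sum_def gr hr of_nat_diff field_simps power2_eq_square power3_eq_cube)
qed

section \<open>Bounded height: the four orders of the breakpoints\<close>

text \<open>The order is \<open>h\<close>, \<open>d\<close>, \<open>n - d\<close>. The clipped
  counts change without a jump at \<open>d / 2\<close>, so one breakpoint \<open>h\<close> suffices
  there for both parities.\<close>

lemma VarB_posRootsLe_le_half:
  assumes "1 \<le> d" "2 * d \<le> n"
  shows "VarB n (posRootsLe n d) = 1/36 * real d ^ 3 + 1/48 * real d ^ 2 + (1/12 * real n + 1/72) * real d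
    + (if even d then 0 else 1/48)"
proof -
  let ?F = "summand (leA n d) (leV n d) (leU n d)"
  define h where "h = d div 2"
  have h: "2 * h \<le> d" "d \<le> 2 * h + 1" by (auto simp: h_def)
  have hr: "real h = (real d - of_bool (odd d)) / 2" by (auto simp: h_def elim!: evenE oddE)
  have s0: "sum ?F {0<..h} = indef_sum (-2) 2 (-2) 0 1 (real h) - indef_sum (-2) 2 (-2) 0 1 (real 0)"
    by (rule sum_eq_indef_sum) (use assms h in \<open>auto simp: leA_def leV_def leU_def min_def max_def\<close>)
  have s1: "sum ?F {h<..d} = indef_sum (int d - 1) 0 (-1) 0 1 (real d) - indef_sum (int d - 1) 0 (-1) 0 1 (real h)"
    by (rule sum_eq_indef_sum) (use assms h in \<open>auto simp: leA_def leV_def leU_def min_def max_def\<close>)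
  have s2: "sum ?F {d<..n - d} = indef_sum (int d) 0 0 0 0 (real (n - d)) - indef_sum (int d) 0 0 0 0 (real d)"
    by (rule sum_eq_indef_sum) (use assms h in \<open>auto simp: leA_def leV_def leU_def min_def max_def\<close>)
  have s3: "sum ?F {n - d<..n} = indef_sum (int d) 0 (int d - int n) 1 0 (real n) - indef_sum (int d) 0 (int d - int n) 1 0 (real (n - d))"
    by (rule sum_eq_indef_sum) (use assms h in \<open>auto simp: leA_def leV_def leU_def min_def max_def\<close>)
  have "sum ?F {0<..n} = sum ?F {0<..h} + sum ?F {h<..d} + sum ?F {d<..n - d} + sum ?F {n - d<..n}"
    using assms h by (simp add: sum_greaterThanAtMost_split[symmetric])
  then show ?thesis
    unfolding VarB_posRootsLe[OF assms(1)] s0 s1 s2 s3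
    using assms by (cases "even d")
      (simp_all add: indef_sum_def hr of_nat_diff field_simps power2_eq_square power3_eq_cube)
qed

text \<open>Now \<open>n - d\<close> lies between \<open>h\<close> and \<open>d\<close>; on
  \<open>{n - d<..d}\<close> the bound \<open>k + d\<close> exceeds \<open>n\<close> while the short
  root at \<open>k\<close> is still present.\<close>

lemma VarB_posRootsLe_le_two_thirds:
  assumes "1 \<le> d" "n \<le> 2 * d" "3 * d \<le> 2 * n"
  shows "VarB n (posRootsLe n d) = 1/36 * real d ^ 3 + 3/16 * real d ^ 2 + (- 1/12 * real n + 7/72) * real d
    + (1/24 * real n ^ 2 - 1/24 * real n) + (if even d then 0 else 1/48)"
proof -
  let ?F = "summand (leA n d) (leV n d) (leU n d)"
  define h where "h = d div 2"
  have h: "2 * h \<le> d" "d \<le> 2 * h + 1" by (auto simp: h_def)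
  have hr: "real h = (real d - of_bool (odd d)) / 2" by (auto simp: h_def elim!: evenE oddE)
  have s0: "sum ?F {0<..h} = indef_sum (-2) 2 (-2) 0 1 (real h) - indef_sum (-2) 2 (-2) 0 1 (real 0)"
    by (rule sum_eq_indef_sum) (use assms h in \<open>auto simp: leA_def leV_def leU_def min_def max_def\<close>)
  have s1: "sum ?F {h<..n - d} = indef_sum (int d - 1) 0 (-1) 0 1 (real (n - d)) - indef_sum (int d - 1) 0 (-1) 0 1 (real h)"
    by (rule sum_eq_indef_sum) (use assms h in \<open>auto simp: leA_def leV_def leU_def min_def max_def\<close>)
  have s2: "sum ?F {n - d<..d} = indef_sum (int d - 1) 0 (int d - int n - 1) 1 1 (real d) - indef_sum (int d - 1) 0 (int d - int n - 1) 1 1 (real (n - d))"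
    by (rule sum_eq_indef_sum) (use assms h in \<open>auto simp: leA_def leV_def leU_def min_def max_def\<close>)
  have s3: "sum ?F {d<..n} = indef_sum (int d) 0 (int d - int n) 1 0 (real n) - indef_sum (int d) 0 (int d - int n) 1 0 (real d)"
    by (rule sum_eq_indef_sum) (use assms h in \<open>auto simp: leA_def leV_def leU_def min_def max_def\<close>)
  have "sum ?F {0<..n} = sum ?F {0<..h} + sum ?F {h<..n - d} + sum ?F {n - d<..d} + sum ?F {d<..n}"
    using assms h by (simp add: sum_greaterThanAtMost_split[symmetric])
  then show ?thesis
    unfolding VarB_posRootsLe[OF assms(1)] s0 s1 s2 s3
    using assms by (cases "even d")
      (simp_all add: indef_sum_def hr of_nat_diff field_simps power2_eq_square power3_eq_cube)
qed

text \<open>Now \<open>n - d \<le> h\<close>, so \<open>k + d\<close> exceeds \<open>n\<close>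
  already for some indices at which roots with second component \<open>- k\<close> may still
  occur.\<close>

lemma VarB_posRootsLe_le_n:
  assumes "1 \<le> d" "2 * n \<le> 3 * d" "d \<le> n"
  shows "VarB n (posRootsLe n d) = 1/36 * real d ^ 3
    + (if even d then (1/6 * real n - 1/36) * real d + (- 1/24 * real n ^ 2 + 1/24 * real n)
       else (1/6 * real n + 7/72) * real d + (- 1/24 * real n ^ 2 - 1/24 * real n + 1/24))"
proof -
  let ?F = "summand (leA n d) (leV n d) (leU n d)"
  define h where "h = d div 2"
  have h: "2 * h \<le> d" "d \<le> 2 * h + 1" by (auto simp: h_def)
  have hr: "real h = (real d - of_bool (odd d)) / 2" by (auto simp: h_def elim!: evenE oddE)
  have s0: "sum ?F {0<..n - d} = indef_sum (-2) 2 (-2) 0 1 (real (n - d)) - indef_sum (-2) 2 (-2) 0 1 (real 0)"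
    by (rule sum_eq_indef_sum) (use assms h in \<open>auto simp: leA_def leV_def leU_def min_def max_def\<close>)
  have s1: "sum ?F {n - d<..h} = indef_sum (-2) 2 (int d - int n - 2) 1 1 (real h) - indef_sum (-2) 2 (int d - int n - 2) 1 1 (real (n - d))"
    by (rule sum_eq_indef_sum) (use assms h in \<open>auto simp: leA_def leV_def leU_def min_def max_def\<close>)
  have s2: "sum ?F {h<..d} = indef_sum (int d - 1) 0 (int d - int n - 1) 1 1 (real d) - indef_sum (int d - 1) 0 (int d - int n - 1) 1 1 (real h)"
    by (rule sum_eq_indef_sum) (use assms h in \<open>auto simp: leA_def leV_def leU_def min_def max_def\<close>)
  have s3: "sum ?F {d<..n} = indef_sum (int d) 0 (int d - int n) 1 0 (real n) - indef_sum (int d) 0 (int d - int n) 1 0 (real d)"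
    by (rule sum_eq_indef_sum) (use assms h in \<open>auto simp: leA_def leV_def leU_def min_def max_def\<close>)
  have "sum ?F {0<..n} = sum ?F {0<..n - d} + sum ?F {n - d<..h} + sum ?F {h<..d} + sum ?F {d<..n}"
    using assms h by (simp add: sum_greaterThanAtMost_split[symmetric])
  then show ?thesis
    unfolding VarB_posRootsLe[OF assms(1)] s0 s1 s2 s3
    using assms by (cases "even d")
      (simp_all add: indef_sum_def hr of_nat_diff field_simps power2_eq_square power3_eq_cube)
qed

text \<open>All short roots are present. Up to \<open>k = d - n\<close> the counts for second
  component \<open>k\<close> and \<open>- k\<close> both equal \<open>n - k\<close> and cancel,
  which leaves \<open>leA\<close>.\<close>

lemma VarB_posRootsLe_ge_n:
  assumes "1 \<le> d" "n \<le> d" "d \<le> 2 * n - 1"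
  shows "VarB n (posRootsLe n d) = - 1/12 * real d ^ 3 + (1/3 * real n - 1/24) * real d ^ 2
    + (if even d then (- 1/3 * real n ^ 2 + 1/6 * real n - 1/24) * real d + (1/9 * real n ^ 3 + 1/18 * real n)
       else (- 1/3 * real n ^ 2 + 1/6 * real n + 1/12) * real d + (1/9 * real n ^ 3 - 1/36 * real n + 1/24))"
proof -
  let ?F = "summand (leA n d) (leV n d) (leU n d)"
  define h where "h = d div 2"
  have h: "2 * h \<le> d" "d \<le> 2 * h + 1" by (auto simp: h_def)
  have hr: "real h = (real d - of_bool (odd d)) / 2" by (auto simp: h_def elim!: evenE oddE)
  have s0: "sum ?F {0<..d - n} = indef_sum (-2) 2 (-2) 2 1 (real (d - n)) - indef_sum (-2) 2 (-2) 2 1 (real 0)"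
    by (rule sum_eq_indef_sum) (use assms h in \<open>auto simp: leA_def leV_def leU_def min_def max_def\<close>)
  have s1: "sum ?F {d - n<..h} = indef_sum (-2) 2 (int d - int n - 2) 1 1 (real h) - indef_sum (-2) 2 (int d - int n - 2) 1 1 (real (d - n))"
    by (rule sum_eq_indef_sum) (use assms h in \<open>auto simp: leA_def leV_def leU_def min_def max_def\<close>)
  have s2: "sum ?F {h<..n} = indef_sum (int d - 1) 0 (int d - int n - 1) 1 1 (real n) - indef_sum (int d - 1) 0 (int d - int n - 1) 1 1 (real h)"
    by (rule sum_eq_indef_sum) (use assms h in \<open>auto simp: leA_def leV_def leU_def min_def max_def\<close>)
  have "sum ?F {0<..n} = sum ?F {0<..d - n} + sum ?F {d - n<..h} + sum ?F {h<..n}"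
    using assms h by (simp add: sum_greaterThanAtMost_split[symmetric])
  then show ?thesis
    unfolding VarB_posRootsLe[OF assms(1)] s0 s1 s2
    using assms by (cases "even d")
      (simp_all add: indef_sum_def hr of_nat_diff field_simps power2_eq_square power3_eq_cube)
qed

theorem theoremA4:
  fixes n d :: nat
  assumes "1 \<le> d" and "d \<le> 2 * n - 1"
  shows
   "(real d \<le> real n / 2 \<and> even d \<longrightarrow>
       VarB n (posRootsEq n d) = real d / 24 + real n / 12 + 1/12) \<and>
    (real d \<le> real n / 2 \<and> odd d \<longrightarrow>
       VarB n (posRootsEq n d) = real d / 24 + real n / 12 + 1/24) \<and>
    (real n / 2 < real d \<and> real d \<le> 2/3 * real n \<and> even d \<longrightarrow>
       VarB n (posRootsEq n d) = real d / 24 + real n / 12 + 1/6) \<and>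
    (real n / 2 < real d \<and> real d \<le> 2/3 * real n \<and> odd d \<longrightarrow>
       VarB n (posRootsEq n d) = real d / 24 + real n / 12 + 1/8) \<and>
    (2/3 * real n < real d \<and> d \<le> n \<and> even d \<longrightarrow>
       VarB n (posRootsEq n d) = real d / 24 + real n / 12) \<and>
    (2/3 * real n \<le> real d \<and> d \<le> n \<and> odd d \<longrightarrow>
       VarB n (posRootsEq n d) = real d / 24 + real n / 12 + 1/8) \<and>
    (n \<le> d \<and> even d \<longrightarrow>
       VarB n (posRootsEq n d) = - real d / 8 + real n / 4) \<and>
    (n \<le> d \<and> odd d \<longrightarrow>
       VarB n (posRootsEq n d) = - real d / 8 + real n / 4 + 1/8) \<and>
    (real d \<le> real n / 2 \<and> even d \<longrightarrow>
       VarB n (posRootsLe n d) =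
         1/36 * real d ^ 3 + 1/48 * real d ^ 2 + (1/12 * real n + 1/72) * real d) \<and>
    (real d \<le> real n / 2 \<and> odd d \<longrightarrow>
       VarB n (posRootsLe n d) =
         1/36 * real d ^ 3 + 1/48 * real d ^ 2 + (1/12 * real n + 1/72) * real d + 1/48) \<and>
    (real n / 2 \<le> real d \<and> real d \<le> 2/3 * real n \<and> even d \<longrightarrow>
       VarB n (posRootsLe n d) =
         1/36 * real d ^ 3 + 3/16 * real d ^ 2 + (- 1/12 * real n + 7/72) * real d
         + (1/24 * real n ^ 2 - 1/24 * real n)) \<and>
    (real n / 2 \<le> real d \<and> real d < 2/3 * real n \<and> odd d \<longrightarrow>
       VarB n (posRootsLe n d) =
         1/36 * real d ^ 3 + 3/16 * real d ^ 2 + (- 1/12 * real n + 7/72) * real d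
         + (1/24 * real n ^ 2 - 1/24 * real n + 1/48)) \<and>
    (2/3 * real n \<le> real d \<and> d \<le> n \<and> even d \<longrightarrow>
       VarB n (posRootsLe n d) =
         1/36 * real d ^ 3 + (1/6 * real n - 1/36) * real d
         + (- 1/24 * real n ^ 2 + 1/24 * real n)) \<and>
    (2/3 * real n \<le> real d \<and> d \<le> n \<and> odd d \<longrightarrow>
       VarB n (posRootsLe n d) =
         1/36 * real d ^ 3 + (1/6 * real n + 7/72) * real d
         + (- 1/24 * real n ^ 2 - 1/24 * real n + 1/24)) \<and>
    (n \<le> d \<and> even d \<longrightarrow>
       VarB n (posRootsLe n d) =
         - 1/12 * real d ^ 3 + (1/3 * real n - 1/24) * real d ^ 2
         + (- 1/3 * real n ^ 2 + 1/6 * real n - 1/24) * real d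
         + (1/9 * real n ^ 3 + 1/18 * real n)) \<and>
    (n \<le> d \<and> odd d \<longrightarrow>
       VarB n (posRootsLe n d) =
         - 1/12 * real d ^ 3 + (1/3 * real n - 1/24) * real d ^ 2
         + (- 1/3 * real n ^ 2 + 1/6 * real n + 1/12) * real d
         + (1/9 * real n ^ 3 - 1/36 * real n + 1/24))"
proof -
  note d = assms(1)
  \<comment> \<open>The case \<open>d = n\<close> comes from the range below \<open>n\<close>: there
    \<open>d / 24 + n / 12\<close> and \<open>- d / 8 + n / 4\<close> both equal
    \<open>n / 8\<close>.\<close>
  have "VarB n (posRootsEq n d) = - real d / 8 + real n / 4 + (if even d then 0 else 1/8)" if "n \<le> d"
  proof (cases "d = n")
    case True
    then show ?thesis using VarB_posRootsEq_le_n[OF d] d by simp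
  qed (use that VarB_posRootsEq_gt_n[OF d _ assms(2)] in simp)
  \<comment> \<open>The odd case is claimed with a non-strict bound; equality would force
    \<open>d\<close> to be even.\<close>
  moreover have "2 * n < 3 * d" if "2 * n \<le> 3 * d" "odd d"
  proof -
    have "2 * n \<noteq> 3 * d" using that(2) by presburger
    then show ?thesis using that(1) by simp
  qed
  moreover have "real d \<le> real n / 2 \<longleftrightarrow> 2 * d \<le> n" "real n / 2 < real d \<longleftrightarrow> n < 2 * d"
    "real n / 2 \<le> real d \<longleftrightarrow> n \<le> 2 * d" "real d \<le> 2/3 * real n \<longleftrightarrow> 3 * d \<le> 2 * n"
    "real d < 2/3 * real n \<longleftrightarrow> 3 * d < 2 * n" "2/3 * real n < real d \<longleftrightarrow> 2 * n < 3 * d"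
    "2/3 * real n \<le> real d \<longleftrightarrow> 2 * n \<le> 3 * d"
    by linarith+
  ultimately show ?thesis
    using VarB_posRootsEq_le_half[OF d, of n] VarB_posRootsEq_le_two_thirds[OF d, of n] VarB_posRootsEq_le_n[OF d, of n]
      VarB_posRootsLe_le_half[OF d, of n] VarB_posRootsLe_le_two_thirds[OF d, of n] VarB_posRootsLe_le_n[OF d, of n]
      VarB_posRootsLe_ge_n[OF d _ assms(2)]
    by (simp (no_asm_simp))
qed

end
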